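(* Let $f$ be an entire function of the form $f(z) = 1 + a z^k + \text{(higher order terms)}$, with $a \in \mathbb{C}\setminus\{0\}$ and $k \in \mathbb{N}=\{1,2,\dots\}$, and suppose that $f$ is not exceptional. Then, near the origin, the maximum modulus set $\mathcal{M}(f)$ consists of exactly $\mu_f$ analytic curves that only meet at zero; that is, there is $R>0$ such that $\mathcal{M}(f)\cap\{z: 0<|z|\le R\}$ is the union of exactly $\mu_f$ pairwise disjoint analytic curves, each of which tends to $0$ at one of its ends.
   Context: For an entire function $f$, $M(r,f) = \max_{|z|=r}|f(z)|$ for $r \ge 0$, and the maximum modulus set is $\mathcal{M}(f) = \{z\in\mathbb{C} : |f(z)| = M(|z|,f)\}$. Let $f(z) = 1 + a z^k + \sum_{\sigma=k+1}^\infty b_\sigma z^\sigma$ be entire with $a\neq 0$, $k\in\mathbb{N}$. Inner degree: $\mu_f$ is the maximal $\mu\in\mathbb{N}$ such that $f(z)=\tilde f(z^\mu)$ for some entire function $\tilde f$ (equivalently the greatest common divisor of $\{n>0: f^{(n)}(0)\ne 0\}$). Core polynomial: put $p_k(z) = 1+az^k$ and, for $n>k$, $p_n(z) = 1 + az^k+\sum_{\sigma=k+1}^n b_\sigma z^\sigma$. Let $N\ge k$ be the least integer such that $\mu_{p_N}=\mu_f$. Then $p_N$ is called the core polynomial of $f$. Exceptional: $f$ is exceptional if there exist $m\in\{1,\dots,2k-3\}$, $m'\in\mathbb{Z}$ and $\sigma\in\{k+1,\dots,N\}$ (where $N\ge k$ is the least integer such that $\mu_{p_N}=\mu_f$) such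 that $b_\sigma\neq 0$ and $$m\pi = \frac{k}{\sigma}\left(m'\pi - \arg b_\sigma\right)+\arg a .$$ (The sets $\{1,\dots,2k-3\}$ and $\{k+1,\dots,N\}$ are understood to be empty when the upper bound is smaller than the lower bound.) Here $\arg a$ and $\arg b_\sigma$ denote fixed choices of the arguments of $a$ and $b_\sigma$. *)

theory Defs
  imports "HOL-Complex_Analysis.Complex_Analysis"
begin

definition max_modulus :: "real \<Rightarrow> (complex \<Rightarrow> complex) \<Rightarrow> real" where
  "max_modulus r f = (SUP z\<in>sphere 0 r. norm (f z))"

definition max_modulus_set :: "(complex \<Rightarrow> complex) \<Rightarrow> complex set" where
  "max_modulus_set f = {z. norm (f z) = max_modulus (norm z) f}"

(* Meaningful for non-constant f only: for constant f there is no greatest such \<mu>. *)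
definition inner_degree :: "(complex \<Rightarrow> complex) \<Rightarrow> nat" where
  "inner_degree f =
     (GREATEST \<mu>. \<mu> \<ge> 1 \<and> (\<exists>g. g holomorphic_on UNIV \<and> (\<forall>z. f z = g (z ^ \<mu>))))"

definition partial_poly :: "complex \<Rightarrow> nat \<Rightarrow> (nat \<Rightarrow> complex) \<Rightarrow> nat \<Rightarrow> complex \<Rightarrow> complex" where
  "partial_poly a k b n z = 1 + a * z ^ k + (\<Sum>\<sigma>=k+1..n. b \<sigma> * z ^ \<sigma>)"

(* The index N for which p_N is the core polynomial of f. *)
definition core_index ::
  "(complex \<Rightarrow> complex) \<Rightarrow> complex \<Rightarrow> nat \<Rightarrow> (nat \<Rightarrow> complex) \<Rightarrow> nat" where
  "core_index f a k b =
     (LEAST N. N \<ge> k \<and> inner_degree (partial_poly a k b N) = inner_degree f)"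

(* \<alpha> and \<beta> \<sigma> stand for the chosen arguments of a and b \<sigma>; a different choice of \<alpha>
   may change whether f is exceptional. The bounds on m are integers, so that no
   m qualifies for k = 1. *)
definition exceptional ::
  "(complex \<Rightarrow> complex) \<Rightarrow> complex \<Rightarrow> nat \<Rightarrow> (nat \<Rightarrow> complex) \<Rightarrow> real \<Rightarrow> (nat \<Rightarrow> real) \<Rightarrow> bool" where
  "exceptional f a k b \<alpha> \<beta> \<longleftrightarrow>
     (\<exists>m \<in> {1 .. 2 * int k - 3}. \<exists>m'::int. \<exists>\<sigma> \<in> {k+1 .. core_index f a k b}.
        b \<sigma> \<noteq> 0 \<and>
        of_int m * pi = real k / real \<sigma> * (of_int m' * pi - \<beta> \<sigma>) + \<alpha>)"

definition real_analytic_on :: "(real \<Rightarrow> complex) \<Rightarrow> real set \<Rightarrow> bool" where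
  "real_analytic_on \<gamma> I \<longleftrightarrow>
     (\<forall>t0\<in>I. \<exists>c. \<exists>\<epsilon>>0. \<forall>t\<in>I. \<bar>t - t0\<bar> < \<epsilon> \<longrightarrow>
        (\<lambda>n. c n * of_real (t - t0) ^ n) sums \<gamma> t)"

(* The trace of a simple regular analytic curve that tends to 0 at its open end;
   the parameter interval is normalised to be (0,1]. *)
definition analytic_curve_to_zero :: "complex set \<Rightarrow> bool" where
  "analytic_curve_to_zero C \<longleftrightarrow>
     (\<exists>\<gamma>. real_analytic_on \<gamma> {0<..1} \<and>
          inj_on \<gamma> {0<..1} \<and>
          (\<forall>t\<in>{0<..1}. vector_derivative \<gamma> (at t within {0<..1}) \<noteq> 0) \<and>
          (\<gamma> \<longlongrightarrow> 0) (at_right 0) \<and>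
          C = \<gamma> ` {0<..1})"

end

theory Submission
  imports Defs
begin

text \<open>
  On a circle the maximum of the modulus of f is a critical point of the angular derivative of
  ln |f|, so z f'(z) / f(z) is real at every point z \<noteq> 0 of the maximum modulus set at which f does
  not vanish. This function is holomorphic near 0 and equals k |a| \<psi>(z)^k there for a conformal
  coordinate \<psi> fixing 0 (straightening_coordinate). Since a z^k must have positive real part at a
  maximum near 0, \<psi>(z)^k is even positive, so the maximum modulus set near 0 lies on the
  k analytic curves whose images under \<psi> are the rays in the directions of the k-th roots of
  unity. Curve j leaves the origin at the angle \<theta>_j = (2 \<pi> j - \<alpha>) / k. All curves are analytic because they are images of
  rays under the holomorphic inverse g of \<psi>.

  It remains to see which of the k curves survive. Rotation by the angle \<theta>_i - \<theta>_j carries curve j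
  to within a small angle of curve i, and it changes the power series only in the terms
  b_\<sigma> z^\<sigma> with k not dividing (i - j) \<sigma>. If \<sigma> is the least index of such a
  term, comparing f at a point of curve j with f at the rotated point is decided by the real parts
  of b_\<sigma> cis (\<sigma> \<theta>_i) and b_\<sigma> cis (\<sigma> \<theta>_j) (rotated_point_larger). These two numbers have the same
  modulus and are distinct, so their real parts agree only if they are complex conjugates, and
  this is the equation that defines exceptional functions, with m = i + j
  (coefficients_separate_rays); the range of m is exactly that of i + j for 0 \<le> i < j < k. So
  for a function that is not exceptional one of the two curves misses the maximum modulus set near 0,
  unless no such \<sigma> exists. The least separating index never exceeds the index of the core polynomial
  (separating_index_below_core_index), and there is none exactly if k divides (i - j) \<mu>,
  where \<mu> is the inner degree.

  The surviving indices are therefore congruent modulo k / \<mu>, and there are at most \<mu> of them. On the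
  other hand f is invariant under rotation by 2 \<pi> / \<mu>, so every circle carries at least \<mu> maxima.
  Each curve meets each small circle once, because its modulus increases along the ray; hence the
  count forces exactly \<mu> curves, all of whose points are maxima (max_modulus_set_from_rays).
\<close>

section \<open>Entire power series and their inner degree\<close>

lemma power_series_entire:
  fixes c :: "nat \<Rightarrow> complex"
  assumes "\<And>z. (\<lambda>n. c n * z ^ n) sums F z"
  shows "F holomorphic_on UNIV"
proof -
  have "F holomorphic_on ball 0 r" for r
    using assms by (intro power_series_holomorphic[where a = c]) simp
  then have "F field_differentiable at z" for z
    using holomorphic_on_imp_differentiable_at[of F "ball 0 (norm z + 1)" z] by simp
  then show ?thesis
    by (simp add: holomorphic_on_def field_differentiable_at_within)
qed

lemma power_series_divide_power:
  fixes c :: "nat \<Rightarrow> complex"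
  assumes sums: "\<And>z. (\<lambda>n. c n * z ^ n) sums F z" and zero: "\<And>n. n < m \<Longrightarrow> c n = 0"
  obtains G where "G holomorphic_on UNIV" "\<And>z. F z = z ^ m * G z" "G 0 = c m"
proof
  define G where "G z = (\<Sum>n. c (n + m) * z ^ n)" for z
  have tail: "(\<lambda>n. z ^ m * (c (n + m) * z ^ n)) sums F z" for z
    using sums_iff_shift[of "\<lambda>n. c n * z ^ n" m "F z"] sums[of z] zero
    by (simp add: power_add mult_ac)
  have G: "(\<lambda>n. c (n + m) * z ^ n) sums G z" for z
  proof (cases "z = 0")
    case True
    then show ?thesis
      using powser_sums_zero[of "\<lambda>n. c (n + m)"] by (simp add: G_def)
  next
    case False
    then show ?thesis
      using tail[of z] by (simp add: sums_summable summable_sums summable_mult_D G_def)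
        (metis mult_eq_0_iff power_not_zero summable_mult_D summable_sums sums_summable)
  qed
  show "G holomorphic_on UNIV"
    using G by (rule power_series_entire)
  show "F z = z ^ m * G z" for z
    using sums_mult[OF G[of z], of "z ^ m"] tail[of z] by (rule sums_unique2[symmetric])
  show "G 0 = c m"
    using powser_sums_zero[of "\<lambda>n. c (n + m)"] G[of 0] by (simp add: sums_unique2)
qed

text \<open>
  Dividing by z^m, where c_m is the first coefficient in doubt, leaves a continuous function with
  value c_m at 0 that vanishes off 0.
\<close>

lemma power_series_zero_coeffs:
  fixes c :: "nat \<Rightarrow> complex"
  assumes sums: "\<And>z. (\<lambda>n. c n * z ^ n) sums 0"
  shows "c n = 0"
proof (induction n rule: less_induct)
  case (less m)
  from power_series_divide_power[of c "\<lambda>_. 0" m, OF sums less]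
  obtain G where G: "G holomorphic_on UNIV" "\<And>z. 0 = z ^ m * G z" "G 0 = c m"
    by blast
  have "(G \<longlongrightarrow> G 0) (at 0)"
    using G(1) by (meson UNIV_I continuous_on_eq_continuous_at holomorphic_on_imp_continuous_on isCont_def open_UNIV)
  moreover have "\<forall>\<^sub>F z in at 0. G z = 0"
    using G(2) by (auto simp: eventually_at intro!: exI[of _ 1])
  ultimately have "G 0 = 0"
    by (metis tendsto_eventually tendsto_unique trivial_limit_at)
  then show ?case
    using G(3) by simp
qed

text \<open>
  Rotation by a primitive d-th root of unity multiplies the coefficient of index n by a factor that
  is 1 exactly if d divides n, so the claim is uniqueness of coefficients.
\<close>

lemma power_series_rotation_invariant_iff:
  fixes c :: "nat \<Rightarrow> complex" and d :: nat
  assumes sums: "\<And>z. (\<lambda>n. c n * z ^ n) sums F z" and "d \<ge> 1"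
  shows "(\<forall>z. F (cis (2 * pi / d) * z) = F z) \<longleftrightarrow> (\<forall>n. c n \<noteq> 0 \<longrightarrow> d dvd n)"
proof -
  have root: "cis (2 * pi / d) ^ n = 1 \<longleftrightarrow> d dvd n" for n
  proof -
    have "cis (2 * pi / d) ^ n = exp (2 * of_real pi * \<i> * of_nat n / of_nat d)"
      unfolding Complex.DeMoivre by (simp add: cis_conv_exp field_simps)
    also have "\<dots> = 1 \<longleftrightarrow> d dvd n"
      using complex_root_unity_eq_1[of d n] \<open>d \<ge> 1\<close> by simp
    finally show ?thesis .
  qed
  show ?thesis
  proof
    assume inv: "\<forall>z. F (cis (2 * pi / d) * z) = F z"
    have "(\<lambda>n. c n * (cis (2 * pi / d) ^ n - 1) * z ^ n) sums 0" for z
      using sums_diff[OF sums[of "cis (2 * pi / d) * z"] sums[of z]] inv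
      by (simp add: power_mult_distrib algebra_simps)
    from power_series_zero_coeffs[of "\<lambda>n. c n * (cis (2 * pi / d) ^ n - 1)", OF this]
    show "\<forall>n. c n \<noteq> 0 \<longrightarrow> d dvd n"
      using root by auto
  next
    assume "\<forall>n. c n \<noteq> 0 \<longrightarrow> d dvd n"
    then have "c n * (cis (2 * pi / d) * z) ^ n = c n * z ^ n" for n z
      using root[of n] by (cases "c n = 0") (simp_all add: power_mult_distrib)
    then show "\<forall>z. F (cis (2 * pi / d) * z) = F z"
      using sums by (metis (no_types, lifting) sums_cong sums_unique2)
  qed
qed

text \<open>
  A function of z^d is invariant under rotation by a d-th root of unity. Conversely, the series in
  z^d converges everywhere because every complex number is a d-th power.
\<close>

lemma factors_through_power_iff:
  fixes c :: "nat \<Rightarrow> complex" and d :: nat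
  assumes sums: "\<And>z. (\<lambda>n. c n * z ^ n) sums F z" and "d \<ge> 1"
  shows "(\<exists>g. g holomorphic_on UNIV \<and> (\<forall>z. F z = g (z ^ d))) \<longleftrightarrow> (\<forall>n. c n \<noteq> 0 \<longrightarrow> d dvd n)"
proof
  assume "\<exists>g. g holomorphic_on UNIV \<and> (\<forall>z. F z = g (z ^ d))"
  moreover have "cis (2 * pi / d) ^ d = 1"
    using \<open>d \<ge> 1\<close> by (simp add: Complex.DeMoivre)
  ultimately have "\<forall>z. F (cis (2 * pi / d) * z) = F z"
    by (auto simp: power_mult_distrib)
  then show "\<forall>n. c n \<noteq> 0 \<longrightarrow> d dvd n"
    using power_series_rotation_invariant_iff[of c F, OF sums \<open>d \<ge> 1\<close>] by blast
next
  assume dvd: "\<forall>n. c n \<noteq> 0 \<longrightarrow> d dvd n"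
  define g where "g w = (\<Sum>m. c (d * m) * w ^ m)" for w
  have sub: "(\<lambda>m. c (d * m) * (z ^ d) ^ m) sums F z" for z
  proof -
    have "strict_mono (\<lambda>m. d * m)"
      using \<open>d \<ge> 1\<close> by (simp add: strict_mono_def)
    moreover have "c n * z ^ n = 0" if "n \<notin> range (\<lambda>m. d * m)" for n
      using that dvd by (auto elim!: dvdE)
    ultimately have "(\<lambda>m. c (d * m) * z ^ (d * m)) sums F z"
      using sums_mono_reindex[of "\<lambda>m. d * m" "\<lambda>n. c n * z ^ n"] sums[of z] by blast
    then show ?thesis
      by (simp add: power_mult)
  qed
  have "(\<lambda>m. c (d * m) * w ^ m) sums g w" for w
  proof -
    obtain z where "z ^ d = w"
      using \<open>d \<ge> 1\<close> exists_complex_root[of d w] by auto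
    then show ?thesis
      using sub[of z] by (auto simp: g_def sums_iff)
  qed
  then have "g holomorphic_on UNIV"
    by (rule power_series_entire)
  moreover have "F z = g (z ^ d)" for z
    using sub[of z] by (simp add: g_def sums_iff)
  ultimately show "\<exists>g. g holomorphic_on UNIV \<and> (\<forall>z. F z = g (z ^ d))"
    by blast
qed

lemma inner_degree_eq_Gcd:
  fixes c :: "nat \<Rightarrow> complex"
  assumes sums: "\<And>z. (\<lambda>n. c n * z ^ n) sums F z" and "c k \<noteq> 0" "k \<ge> 1"
  shows "inner_degree F = Gcd {n. c n \<noteq> 0}"
proof -
  let ?D = "Gcd {n. c n \<noteq> 0}"
  have pos: "?D \<ge> 1"
    using assms(2,3) by (metis Gcd_dvd_nat One_nat_def Suc_leI dvd_0_left_iff gr0I mem_Collect_eq not_one_le_zero)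
  have iff: "\<mu> \<ge> 1 \<and> (\<exists>g. g holomorphic_on UNIV \<and> (\<forall>z. F z = g (z ^ \<mu>))) \<longleftrightarrow> \<mu> \<ge> 1 \<and> \<mu> dvd ?D" for \<mu>
    using factors_through_power_iff[of c F \<mu>, OF sums] by (auto simp: dvd_Gcd_iff)
  show ?thesis
    unfolding inner_degree_def iff
    using pos by (intro Greatest_equality) (auto intro: dvd_imp_le)
qed

text \<open>
  The greatest common divisors of the initial segments decrease along divisibility, so they are
  constant from the point on where their minimum is attained.
\<close>

lemma Gcd_eq_Gcd_initial_segment:
  fixes S :: "nat set"
  assumes "k \<in> S" "k \<ge> 1"
  obtains N where "N \<ge> k" "Gcd (S \<inter> {..N}) = Gcd S"
proof -
  let ?G = "\<lambda>N. Gcd (S \<inter> {..N})"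
  obtain N where N: "N \<ge> k" and min: "\<And>M. M \<ge> k \<Longrightarrow> ?G N \<le> ?G M"
    using ex_has_least_nat[of "\<lambda>N. N \<ge> k" k ?G] by auto
  have "?G N dvd n" if "n \<in> S" for n
  proof -
    \<comment> \<open>Enlarging the segment to contain n cannot lower the minimal value.\<close>
    let ?M = "max N n"
    have "?G ?M dvd ?G N"
      by (intro Gcd_greatest Gcd_dvd) auto
    moreover have "?G N \<noteq> 0"
      using assms N by (metis Gcd_dvd_nat IntI atMost_iff dvd_0_left_iff not_one_le_zero)
    ultimately have "?G ?M = ?G N"
      using min[of ?M] N by (meson dvd_imp_le gr0I le_antisym le_max_iff_disj)
    moreover have "?G ?M dvd n"
      using that by (intro Gcd_dvd) auto
    ultimately show ?thesis by simp
  qed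
  then have "?G N dvd Gcd S"
    by (rule Gcd_greatest)
  moreover have "Gcd S dvd ?G N"
    by (intro Gcd_greatest Gcd_dvd) auto
  ultimately have "?G N = Gcd S"
    by (rule dvd_antisym)
  with N show ?thesis
    using that by blast
qed

section \<open>Coefficients and the core polynomial\<close>

definition series_coeff :: "complex \<Rightarrow> nat \<Rightarrow> (nat \<Rightarrow> complex) \<Rightarrow> nat \<Rightarrow> complex" where
  "series_coeff a k b n = (if n = 0 then 1 else if n = k then a else if n > k then b n else 0)"

lemma series_coeff_sums:
  assumes "k \<ge> 1" and "((\<lambda>\<sigma>. b \<sigma> * z ^ \<sigma>) has_sum (w - (1 + a * z ^ k))) {k+1..}"
  shows "(\<lambda>n. series_coeff a k b n * z ^ n) sums w"
proof -
  have "((\<lambda>n. if n > k then b n * z ^ n else 0) has_sum (w - (1 + a * z ^ k))) UNIV"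
    using assms(2) by (rule has_sum_cong_neutral[THEN iffD1, rotated 3]) auto
  then have tail: "(\<lambda>n. if n > k then b n * z ^ n else 0) sums (w - (1 + a * z ^ k))"
    by (rule has_sum_imp_sums)
  have "(\<lambda>n. if n \<in> {0, k} then series_coeff a k b n * z ^ n else 0) sums
      (\<Sum>n\<in>{0, k}. series_coeff a k b n * z ^ n)"
    by (rule sums_If_finite_set) simp
  also have "(\<Sum>n\<in>{0, k}. series_coeff a k b n * z ^ n) = 1 + a * z ^ k"
    using \<open>k \<ge> 1\<close> by (simp add: series_coeff_def)
  finally have "(\<lambda>n. (if n \<in> {0, k} then series_coeff a k b n * z ^ n else 0) +
      (if n > k then b n * z ^ n else 0)) sums (1 + a * z ^ k + (w - (1 + a * z ^ k)))"
    using tail by (rule sums_add)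
  also have "(\<lambda>n. (if n \<in> {0, k} then series_coeff a k b n * z ^ n else 0) +
      (if n > k then b n * z ^ n else 0)) = (\<lambda>n. series_coeff a k b n * z ^ n)"
    by (auto simp: series_coeff_def)
  finally show ?thesis
    by simp
qed

lemma partial_poly_sums:
  assumes "k \<ge> 1"
  shows "(\<lambda>n. series_coeff a k (\<lambda>\<sigma>. if \<sigma> \<le> N then b \<sigma> else 0) n * z ^ n) sums partial_poly a k b N z"
proof (rule series_coeff_sums[OF assms])
  have "((\<lambda>\<sigma>. b \<sigma> * z ^ \<sigma>) has_sum (\<Sum>\<sigma>=k+1..N. b \<sigma> * z ^ \<sigma>)) {k+1..N}"
    by (rule has_sum_finite) simp
  then have "((\<lambda>\<sigma>. (if \<sigma> \<le> N then b \<sigma> else 0) * z ^ \<sigma>) has_sum (\<Sum>\<sigma>=k+1..N. b \<sigma> * z ^ \<sigma>)) {k+1..}"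
    by (rule has_sum_cong_neutral[THEN iffD1, rotated 3]) auto
  then show "((\<lambda>\<sigma>. (if \<sigma> \<le> N then b \<sigma> else 0) * z ^ \<sigma>) has_sum
      (partial_poly a k b N z - (1 + a * z ^ k))) {k+1..}"
    by (simp add: partial_poly_def)
qed

text \<open>
  The core polynomial has the same inner degree as f. If k divided d \<sigma> for all its exponents
  \<sigma>, then k would divide d times their greatest common divisor.
\<close>

lemma separating_index_below_core_index:
  assumes "k \<ge> 1" "a \<noteq> 0"
    and sums: "\<And>z. (\<lambda>n. series_coeff a k b n * z ^ n) sums f z"
    and ndvd: "\<not> k dvd d * inner_degree f"
  shows "\<exists>\<sigma>\<in>{k+1..core_index f a k b}. b \<sigma> \<noteq> 0 \<and> \<not> k dvd d * \<sigma>"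
proof (rule ccontr)
  assume contr: "\<not> ?thesis"
  define S where "S = {n. series_coeff a k b n \<noteq> 0}"
  let ?N = "core_index f a k b"
  have ck: "series_coeff a k b k \<noteq> 0" for b
    using \<open>k \<ge> 1\<close> \<open>a \<noteq> 0\<close> by (simp add: series_coeff_def)
  have deg_f: "inner_degree f = Gcd S"
    unfolding S_def using inner_degree_eq_Gcd[OF sums ck \<open>k \<ge> 1\<close>] .
  have deg_p: "inner_degree (partial_poly a k b N) = Gcd (S \<inter> {..N})" if "N \<ge> k" for N
  proof -
    have "{n. series_coeff a k (\<lambda>\<sigma>. if \<sigma> \<le> N then b \<sigma> else 0) n \<noteq> 0} = S \<inter> {..N}"
      using that \<open>a \<noteq> 0\<close> by (auto simp: S_def series_coeff_def)
    then show ?thesis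
      using inner_degree_eq_Gcd[OF partial_poly_sums[OF \<open>k \<ge> 1\<close>] ck \<open>k \<ge> 1\<close>] by simp
  qed
  obtain N where "N \<ge> k" "Gcd (S \<inter> {..N}) = Gcd S"
    using Gcd_eq_Gcd_initial_segment[of k S] \<open>k \<ge> 1\<close> ck by (auto simp: S_def)
  then have "N \<ge> k \<and> inner_degree (partial_poly a k b N) = inner_degree f"
    using deg_f deg_p by simp
  then have N: "?N \<ge> k \<and> inner_degree (partial_poly a k b ?N) = inner_degree f"
    unfolding core_index_def by (rule LeastI)
  have "k dvd d * n" if "n \<in> S \<inter> {..?N}" for n
    using that contr by (cases n k rule: linorder_cases) (auto simp: S_def series_coeff_def split: if_splits)
  then have "k dvd Gcd ((*) d ` (S \<inter> {..?N}))"
    by (intro Gcd_greatest) auto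
  also have "\<dots> = d * inner_degree f"
    using N deg_p[of ?N] by (simp add: Gcd_mult)
  finally show False
    using ndvd by simp
qed


section \<open>Points of maximum modulus on a circle\<close>

lemma max_modulus_set_iff:
  assumes "continuous_on UNIV f"
  shows "z \<in> max_modulus_set f \<longleftrightarrow> (\<forall>w. norm w = norm z \<longrightarrow> norm (f w) \<le> norm (f z))"
proof -
  have "continuous_on (sphere 0 (norm z)) (\<lambda>w. norm (f w))"
    using assms continuous_on_subset by (blast intro: continuous_on_norm)
  then have bdd: "bdd_above ((\<lambda>w. norm (f w)) ` sphere 0 (norm z))"
    by (intro compact_imp_bounded[THEN bounded_imp_bdd_above] compact_continuous_image) auto
  show ?thesis
  proof
    assume "z \<in> max_modulus_set f"
    then show "\<forall>w. norm w = norm z \<longrightarrow> norm (f w) \<le> norm (f z)"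
      using cSUP_upper[OF _ bdd] by (simp add: max_modulus_set_def max_modulus_def)
  next
    assume le: "\<forall>w. norm w = norm z \<longrightarrow> norm (f w) \<le> norm (f z)"
    have "(SUP w\<in>sphere 0 (norm z). norm (f w)) = norm (f z)"
      using le by (intro cSup_eq_maximum) auto
    then show "z \<in> max_modulus_set f"
      by (simp add: max_modulus_set_def max_modulus_def)
  qed
qed

lemma max_modulus_set_meets_circle:
  assumes "continuous_on UNIV f" "r \<ge> 0"
  obtains z where "z \<in> max_modulus_set f" "norm z = r"
proof -
  have "continuous_on (sphere 0 r) (\<lambda>w. norm (f w))"
    using assms(1) continuous_on_subset by (blast intro: continuous_on_norm)
  moreover have "sphere (0::complex) r \<noteq> {}"
    using \<open>r \<ge> 0\<close> by simp
  ultimately obtain z where "z \<in> sphere 0 r" "\<forall>w\<in>sphere 0 r. norm (f w) \<le> norm (f z)"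
    using continuous_attains_sup[of "sphere 0 r" "\<lambda>w. norm (f w)"] by auto
  then show ?thesis
    using that[of z] by (auto simp: max_modulus_set_iff[OF assms(1)])
qed

lemma isCont_eventually_near:
  fixes h :: "complex \<Rightarrow> complex"
  assumes "isCont h x" "e > 0"
  shows "\<forall>\<^sub>F z in nhds x. norm (h z - h x) < e"
  using assms tendstoD[of h "h x" "nhds x" e]
  by (simp add: isCont_def tendsto_at_iff_tendsto_nhds dist_norm)

lemma Re_of_real_times: "Re (of_real r * w) = r * Re w"
  by simp

lemma DERIV_norm_power2:
  assumes "(\<gamma> has_vector_derivative d) (at t)"
  shows "((\<lambda>t. (norm (\<gamma> t :: complex))\<^sup>2) has_real_derivative 2 * Re (d * cnj (\<gamma> t))) (at t)"
proof -
  have "((\<lambda>t. Re (\<gamma> t)) has_real_derivative Re d) (at t)" "((\<lambda>t. Im (\<gamma> t)) has_real_derivative Im d) (at t)"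
    unfolding has_real_derivative_iff_has_vector_derivative
    using assms by (auto intro: bounded_linear.has_vector_derivative bounded_linear_Re bounded_linear_Im)
  then show ?thesis
    unfolding cmod_power2
    by (intro DERIV_cong[OF DERIV_add[OF DERIV_power[where n = 2] DERIV_power[where n = 2]]])
      (auto simp: algebra_simps)
qed

text \<open>
  The derivative of |f(z cis t)|^2 at t = 0 is -2 |f(z)|^2 Im (z f'(z) / f(z)), and it vanishes at a
  maximum.
\<close>

lemma max_modulus_log_derivative_real:
  assumes hol: "f holomorphic_on UNIV" and z: "z \<in> max_modulus_set f" "f z \<noteq> 0"
  shows "Im (z * deriv f z / f z) = 0"
proof -
  have der: "((\<lambda>t. f (z * cis t)) has_vector_derivative (\<i> * z * deriv f z)) (at 0)"
  proof -
    have "(f has_field_derivative deriv f (z * exp (\<i> * of_real 0))) (at (z * exp (\<i> * of_real 0)))"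
      using hol by (intro holomorphic_derivI) auto
    moreover have "((\<lambda>w. z * exp (\<i> * w)) has_field_derivative z * \<i>) (at (of_real 0))"
      by (auto intro!: derivative_eq_intros)
    ultimately have "((\<lambda>w. f (z * exp (\<i> * w))) has_field_derivative deriv f z * (z * \<i>)) (at (of_real 0))"
      using DERIV_chain2 by fastforce
    then show ?thesis
      using has_vector_derivative_real_field[of "\<lambda>w. f (z * exp (\<i> * w))" "deriv f z * (z * \<i>)" 0 UNIV]
      by (simp add: cis_conv_exp mult_ac)
  qed
  have "2 * Re (\<i> * z * deriv f z * cnj (f (z * cis 0))) = 0"
  proof (rule DERIV_local_max[OF DERIV_norm_power2[OF der], of 1])
    show "\<forall>y. \<bar>0 - y\<bar> < 1 \<longrightarrow> (norm (f (z * cis y)))\<^sup>2 \<le> (norm (f (z * cis 0)))\<^sup>2"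
      using z(1) hol by (auto simp: max_modulus_set_iff holomorphic_on_imp_continuous_on norm_mult)
  qed simp
  then have "Im (z * deriv f z * cnj (f z)) = 0"
    by (simp add: mult.assoc)
  moreover have "z * deriv f z / f z = z * deriv f z * cnj (f z) / of_real ((norm (f z))\<^sup>2)"
    using z(2) by (simp add: complex_norm_square[symmetric] field_simps)
  ultimately show ?thesis
    by (simp only: Im_divide_of_real)
qed

text \<open>
  With s = |a z^k|, the circle through z contains a point at which the leading term a w^k is the
  positive number s, so the maximum exceeds 1 + s - s/4. If the leading term at z had nonpositive real
  part, then |1 + a z^k|^2 would be at most 1 + s^2 and |f(z)| would be below 1 + s/2 + s/4.
\<close>

lemma max_modulus_leading_term_positive:
  assumes cont: "continuous_on UNIV f" and z: "z \<in> max_modulus_set f" "z \<noteq> 0"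
    and fA: "\<And>w. f w = 1 + w ^ k * A w" and "k \<ge> 1" and \<alpha>: "is_Arg a \<alpha>"
    and close: "\<And>w. norm w = norm z \<Longrightarrow> norm (A w - a) < norm a / 4"
    and small: "norm a * norm z ^ k < 1"
  shows "Re (a * z ^ k) > 0"
proof (rule ccontr)
  assume neg: "\<not> Re (a * z ^ k) > 0"
  define r where "r = norm z"
  have "r > 0"
    using z(2) by (simp add: r_def)
  define s where "s = norm a * r ^ k"
  have "norm a > 0"
    using close[of z] norm_ge_zero[of "A z - a"] by linarith
  then have s: "0 < s" "s < 1"
    using \<open>r > 0\<close> small by (simp_all add: s_def r_def)
  have err: "norm (w ^ k * A w - a * w ^ k) < s / 4" if "norm w = r" for w
  proof -
    have "norm (w ^ k * A w - a * w ^ k) = r ^ k * norm (A w - a)"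
      using that by (metis mult.commute norm_mult norm_power right_diff_distrib)
    also have "\<dots> < r ^ k * (norm a / 4)"
      using that close \<open>r > 0\<close> by (intro mult_strict_left_mono) (auto simp: r_def)
    finally show ?thesis
      by (simp add: s_def mult_ac)
  qed
  define w where "w = of_real r * cis (- \<alpha> / k)"
  have w: "norm w = r"
    using \<open>r > 0\<close> by (simp add: w_def norm_mult)
  have "a * w ^ k = of_real s"
  proof -
    have "w ^ k = of_real (r ^ k) * cis (- \<alpha>)"
      using \<open>k \<ge> 1\<close> by (simp add: w_def power_mult_distrib Complex.DeMoivre)
    moreover have "a = of_real (norm a) * cis \<alpha>"
      using \<alpha> by (simp add: is_Arg_def cis_conv_exp mult_ac)
    ultimately have "a * w ^ k = of_real (norm a) * of_real (r ^ k) * (cis \<alpha> * cis (- \<alpha>))"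
      by (metis (no_types, lifting) mult.assoc mult.left_commute)
    then show ?thesis
      by (simp add: s_def cis_mult)
  qed
  then have "norm (f w) > 1 + s - s / 4"
  proof -
    have "norm (1 + of_real s :: complex) = 1 + s"
      using s by (metis abs_of_pos add_pos_pos norm_of_real of_real_1 of_real_add zero_less_one)
    then show ?thesis
      using err[OF w] \<open>a * w ^ k = of_real s\<close> norm_triangle_ineq2[of "1 + of_real s" "of_real s - w ^ k * A w"]
      by (simp add: fA norm_minus_commute)
  qed
  moreover have "norm (f z) < 1 + s / 2 + s / 4"
  proof -
    have "(norm (1 + a * z ^ k))\<^sup>2 = 1 + 2 * Re (a * z ^ k) + (norm (a * z ^ k))\<^sup>2"
      unfolding cmod_power2 by (simp add: power2_eq_square algebra_simps)
    also have "norm (a * z ^ k) = s"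
      by (simp add: s_def r_def norm_mult norm_power)
    also have "1 + 2 * Re (a * z ^ k) + s\<^sup>2 \<le> 1 + s"
      using neg s by (simp add: power2_eq_square mult_le_one) (smt (verit) mult_left_le)
    also have "\<dots> \<le> (1 + s / 2)\<^sup>2"
      by (simp add: power2_eq_square algebra_simps)
    finally have "norm (1 + a * z ^ k) \<le> 1 + s / 2"
      by (rule power2_le_imp_le) (use s in simp)
    then show ?thesis
      using err[of z] norm_triangle_ineq[of "1 + a * z ^ k" "z ^ k * A z - a * z ^ k"]
      by (simp add: fA r_def)
  qed
  moreover have "norm (f w) \<le> norm (f z)"
    using z(1) w by (simp add: max_modulus_set_iff[OF cont] r_def)
  ultimately show False
    by linarith
qed

text \<open>
  Write f(z) = 1 + z^k A(z). Then z f'(z) / f(z) = k a z^k U(z) with U holomorphic near 0 and U(0) = 1,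
  so its quotient by k |a| has a holomorphic k-th root \<psi> near 0. The branch of the root is fixed by the
  chosen argument of a, and the chosen argument thereby determines the numbering of the rays. At a maximum
  \<psi>(z)^k is real, and its sign is that of the real part of a z^k because U has positive
  real part.
\<close>

lemma straightening_coordinate:
  assumes f: "f holomorphic_on UNIV" and A: "A holomorphic_on UNIV"
    and fA: "\<And>w. f w = 1 + w ^ k * A w" and "k \<ge> 1" and A0: "A 0 = a" and "a \<noteq> 0"
    and \<alpha>: "is_Arg a \<alpha>"
  obtains \<psi> \<rho> where "\<rho> > 0" "\<psi> holomorphic_on ball 0 \<rho>" "\<psi> 0 = 0" "deriv \<psi> 0 = cis (\<alpha> / k)"
    "\<And>z. z \<in> ball 0 \<rho> \<Longrightarrow> z \<in> max_modulus_set f \<Longrightarrow>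
       \<exists>j<k. \<psi> z = of_real (norm (\<psi> z)) * cis (2 * pi * j / k)"
proof -
  define U where "U z = (of_nat k * A z + z * deriv A z) / (of_nat k * a * f z)" for z
  have contf: "continuous_on UNIV f"
    using f by (rule holomorphic_on_imp_continuous_on)
  have [simp]: "f 0 = 1"
    using \<open>k \<ge> 1\<close> by (simp add: fA power_0_left)
  have [simp]: "U 0 = 1"
    using \<open>k \<ge> 1\<close> \<open>a \<noteq> 0\<close> by (simp add: U_def A0)
  have dA: "deriv A holomorphic_on UNIV"
    using A by (simp add: holomorphic_deriv)
  have isf: "isCont f 0" and isA: "isCont A 0" and isdA: "isCont (deriv A) 0"
    using f A dA holomorphic_on_imp_continuous_on continuous_on_eq_continuous_at[OF open_UNIV] by blast+
  have "isCont U 0"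
    unfolding U_def using isf isA isdA \<open>k \<ge> 1\<close> \<open>a \<noteq> 0\<close> by (intro continuous_intros) auto
  then have "\<forall>\<^sub>F z in nhds 0. norm (U z - 1) < 1"
    using isCont_eventually_near[where h = U and x = 0 and e = 1] by simp
  moreover have "\<forall>\<^sub>F z in nhds 0. norm (f z - 1) < 1"
    using isCont_eventually_near[OF isf, of 1] by simp
  moreover have "\<forall>\<^sub>F z in nhds 0. norm (A z - a) < norm a / 4"
    using isCont_eventually_near[OF isA, of "norm a / 4"] A0 \<open>a \<noteq> 0\<close> by simp
  moreover have "\<forall>\<^sub>F z::complex in nhds 0. norm a * norm z ^ k < 1"
  proof -
    have "((\<lambda>z::complex. norm a * norm z ^ k) \<longlongrightarrow> norm a * norm (0::complex) ^ k) (nhds 0)"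
      by (intro tendsto_intros filterlim_ident)
    then show ?thesis
      using \<open>k \<ge> 1\<close> by (intro order_tendstoD(2)[of _ 0]) (auto simp: power_0_left)
  qed
  ultimately have "\<forall>\<^sub>F z in nhds 0. norm (U z - 1) < 1 \<and> norm (f z - 1) < 1 \<and>
      norm (A z - a) < norm a / 4 \<and> norm a * norm z ^ k < 1"
    by eventually_elim simp
  then obtain \<rho> where "\<rho> > 0" and \<rho>: "\<And>z. norm z < \<rho> \<Longrightarrow> norm (U z - 1) < 1 \<and> norm (f z - 1) < 1 \<and>
      norm (A z - a) < norm a / 4 \<and> norm a * norm z ^ k < 1"
    unfolding eventually_nhds_metric by (auto simp: dist_norm)
  have fne: "f z \<noteq> 0" if "norm z < \<rho>" for z
    using \<rho>[OF that] by auto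
  have ReU: "Re (U z) > 0" if "norm z < \<rho>" for z
    using \<rho>[OF that] abs_Re_le_cmod[of "U z - 1"] by (simp; linarith)
  have holU: "U holomorphic_on ball 0 \<rho>"
    unfolding U_def using f A dA \<open>k \<ge> 1\<close> \<open>a \<noteq> 0\<close> fne
    by (intro holomorphic_intros) (auto intro: holomorphic_on_subset)
  define \<phi> where "\<phi> z = cis (\<alpha> / k) * exp (Ln (U z) / of_nat k)" for z
  define \<psi> where "\<psi> z = z * \<phi> z" for z
  have holphi: "\<phi> holomorphic_on ball 0 \<rho>"
    unfolding \<phi>_def using holU ReU \<open>k \<ge> 1\<close>
    by (intro holomorphic_intros) (force simp: complex_nonpos_Reals_iff)+
  have phik: "\<phi> z ^ k = cis \<alpha> * U z" if "norm z < \<rho>" for z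
  proof -
    have "U z \<noteq> 0"
      using ReU[OF that] by auto
    then show ?thesis
      using \<open>k \<ge> 1\<close> by (simp add: \<phi>_def power_mult_distrib Complex.DeMoivre exp_of_nat_mult[symmetric])
  qed
  have a: "a = of_real (norm a) * cis \<alpha>"
    using \<alpha> by (simp add: is_Arg_def cis_conv_exp mult_ac)
  have log_deriv: "z * deriv f z / f z = of_real (k * norm a) * \<psi> z ^ k" if "norm z < \<rho>" for z
  proof -
    have "(A has_field_derivative deriv A z) (at z)"
      using A by (simp add: holomorphic_derivI)
    then have "((\<lambda>w. 1 + w ^ k * A w) has_field_derivative
        z ^ k * deriv A z + of_nat k * z ^ (k - 1) * A z) (at z)"
      by (auto intro!: derivative_eq_intros)
    moreover have "(\<lambda>w. 1 + w ^ k * A w) = f"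
      using fA by auto
    ultimately have "deriv f z = z ^ k * deriv A z + of_nat k * z ^ (k - 1) * A z"
      by (simp add: DERIV_imp_deriv)
    then have e1: "z * deriv f z = z ^ k * (of_nat k * A z + z * deriv A z)"
      using \<open>k \<ge> 1\<close> by (cases k) (simp_all add: algebra_simps)
    have "of_real (k * norm a) * \<psi> z ^ k = z ^ k * (of_nat k * (of_real (norm a) * cis \<alpha>) * U z)"
      by (simp add: \<psi>_def power_mult_distrib phik[OF that] mult_ac)
    then have e2: "of_real (k * norm a) * \<psi> z ^ k = z ^ k * (of_nat k * a * U z)"
      unfolding a[symmetric] .
    have e3: "of_nat k * a * U z = (of_nat k * A z + z * deriv A z) / f z"
      using \<open>k \<ge> 1\<close> \<open>a \<noteq> 0\<close> by (simp add: U_def)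
    show ?thesis
      by (simp only: e1 e2 e3 times_divide_eq_right)
  qed
  show ?thesis
  proof
    show "\<rho> > 0" by fact
    show "\<psi> holomorphic_on ball 0 \<rho>"
      unfolding \<psi>_def using holphi by (intro holomorphic_intros)
    show "\<psi> 0 = 0"
      by (simp add: \<psi>_def)
    have "(\<phi> has_field_derivative deriv \<phi> 0) (at 0)"
      using holphi \<open>\<rho> > 0\<close> by (intro holomorphic_derivI[of _ "ball 0 \<rho>"]) auto
    then have "(\<psi> has_field_derivative \<phi> 0) (at 0)"
      unfolding \<psi>_def by (auto intro!: derivative_eq_intros)
    then show "deriv \<psi> 0 = cis (\<alpha> / k)"
      by (simp add: DERIV_imp_deriv \<phi>_def)
  next
    fix z assume "z \<in> ball 0 \<rho>" and M: "z \<in> max_modulus_set f"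
    then have z: "norm z < \<rho>" by simp
    show "\<exists>j<k. \<psi> z = of_real (norm (\<psi> z)) * cis (2 * pi * j / k)"
    proof (cases "z = 0")
      case True
      then show ?thesis
        using \<open>k \<ge> 1\<close> by (intro exI[of _ 0]) (simp add: \<psi>_def)
    next
      case False
      have "Re (a * z ^ k) > 0"
        using max_modulus_leading_term_positive[of f z k A a \<alpha>] contf M False fA \<open>k \<ge> 1\<close> \<alpha> \<rho> z
        by auto
      have "Im (of_real (k * norm a) * \<psi> z ^ k) = 0"
        using max_modulus_log_derivative_real[OF f M fne[OF z]] log_deriv[OF z] by simp
      then have Im0: "Im (\<psi> z ^ k) = 0"
        using \<open>k \<ge> 1\<close> \<open>a \<noteq> 0\<close> by simp
      define s where "s = Re (\<psi> z ^ k)"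
      have s: "\<psi> z ^ k = of_real s"
        using Im0 by (simp add: s_def complex_eq_iff)
      have "a * z ^ k * U z = of_real (norm a * s)"
      proof -
        have "of_real (norm a) * \<psi> z ^ k = (of_real (norm a) * cis \<alpha>) * z ^ k * U z"
          by (simp add: \<psi>_def power_mult_distrib phik[OF z])
        then show ?thesis
          unfolding a[symmetric] s by simp
      qed
      then have "of_real ((norm (U z))\<^sup>2) * (a * z ^ k) = of_real (norm a * s) * cnj (U z)"
        unfolding complex_norm_square by (metis mult.assoc mult.commute)
      then have "Re (of_real ((norm (U z))\<^sup>2) * (a * z ^ k)) = Re (of_real (norm a * s) * cnj (U z))"
        by (rule arg_cong)
      then have "(norm (U z))\<^sup>2 * Re (a * z ^ k) = norm a * s * Re (U z)"
        unfolding Re_of_real_times by simp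
      moreover have "(norm (U z))\<^sup>2 * Re (a * z ^ k) > 0"
        using \<open>Re (a * z ^ k) > 0\<close> ReU[OF z] by (intro mult_pos_pos) auto
      ultimately have "s > 0"
        using ReU[OF z] \<open>a \<noteq> 0\<close> by (simp add: zero_less_mult_iff)
      have "norm (\<psi> z) ^ k = s"
        using s \<open>s > 0\<close> by (metis abs_of_pos norm_of_real norm_power)
      then have "(\<psi> z / of_real (norm (\<psi> z))) ^ k = 1"
        using s \<open>s > 0\<close> by (simp add: power_divide flip: of_real_power)
      then obtain j where "j < k" "\<psi> z / of_real (norm (\<psi> z)) = cis (2 * pi * real j / real k)"
        using bij_betw_imp_surj_on[OF Complex.bij_betw_roots_unity[of k]] \<open>k \<ge> 1\<close> by auto
      moreover have "norm (\<psi> z) \<noteq> 0"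
        using \<open>norm (\<psi> z) ^ k = s\<close> \<open>s > 0\<close> \<open>k \<ge> 1\<close> by (auto simp: power_0_left)
      ultimately show ?thesis
        by (intro exI[of _ j]) (simp add: field_simps)
    qed
  qed
qed

section \<open>Images of rays under conformal maps\<close>

text \<open>
  Along a ray the real part of w g'(w) / g(w) is the derivative of ln |g(w)| with respect to ln |w|. It
  tends to 1 at 0 since g has a simple zero there, so |g| increases along every short ray.
\<close>

lemma conformal_inverse_radially_increasing:
  assumes "\<psi> holomorphic_on ball 0 \<rho>" "\<rho> > 0" "\<psi> 0 = 0" "deriv \<psi> 0 \<noteq> 0"
  obtains g \<delta> \<epsilon> where "\<delta> > 0" "\<epsilon> > 0" "g holomorphic_on ball 0 \<delta>" "inj_on g (ball 0 \<delta>)" "g 0 = 0"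
    "((\<lambda>w. g w / w) \<longlongrightarrow> 1 / deriv \<psi> 0) (at 0)"
    "\<And>w. w \<in> ball 0 \<delta> \<Longrightarrow> w \<noteq> 0 \<Longrightarrow> Re (w * deriv g w / g w) > 0"
    "\<And>z. z \<in> ball 0 \<epsilon> \<Longrightarrow> \<psi> z \<in> ball 0 \<delta> \<and> g (\<psi> z) = z"
proof -
  have 0: "0 \<in> ball (0::complex) \<rho>"
    using \<open>\<rho> > 0\<close> by simp
  obtain r where r: "r > 0" "ball (0::complex) r \<subseteq> ball 0 \<rho>" "open (\<psi> ` ball 0 r)" "inj_on \<psi> (ball 0 r)"
    by (rule has_complex_derivative_locally_invertible[OF assms(1) 0 open_ball assms(4)]) (rule that)
  have hol: "\<psi> holomorphic_on ball 0 r"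
    using assms(1) r(2) by (rule holomorphic_on_subset)
  obtain g where g: "g holomorphic_on \<psi> ` ball 0 r"
    "\<And>z. z \<in> ball 0 r \<Longrightarrow> deriv \<psi> z * deriv g (\<psi> z) = 1" "\<And>z. z \<in> ball 0 r \<Longrightarrow> g (\<psi> z) = z"
    by (rule holomorphic_has_inverse[OF hol open_ball r(4)]) (rule that)
  have 0: "0 \<in> \<psi> ` ball 0 r"
    using r(1) assms(3) by (metis centre_in_ball image_eqI)
  have g0: "g 0 = 0"
    using g(3)[of 0] r(1) assms(3) by simp
  have dg0: "deriv g 0 = 1 / deriv \<psi> 0"
    using g(2)[of 0] r(1) assms(3,4) by (simp add: field_simps)
  have quot: "((\<lambda>w. g w / w) \<longlongrightarrow> deriv g 0) (at 0)"
    using holomorphic_derivI[OF g(1) r(3) 0, of UNIV] g0 by (simp add: has_field_derivative_iff)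
  have "deriv g holomorphic_on \<psi> ` ball 0 r"
    using g(1) r(3) by (rule holomorphic_deriv)
  then have "isCont (deriv g) 0"
    using r(3) 0 continuous_on_eq_continuous_at holomorphic_on_imp_continuous_on by blast
  then have "((\<lambda>w. deriv g w / (g w / w)) \<longlongrightarrow> deriv g 0 / deriv g 0) (at 0)"
    using quot dg0 assms(4) by (intro tendsto_divide) (auto simp: isCont_def)
  then have "((\<lambda>w. Re (w * deriv g w / g w)) \<longlongrightarrow> 1) (at 0)"
    using dg0 assms(4) tendsto_Re[of _ "1::complex"] by (simp add: mult.commute)
  then have "\<forall>\<^sub>F w in at 0. Re (w * deriv g w / g w) > 0"
    by (rule order_tendstoD) simp
  then obtain \<delta>1 where \<delta>1: "\<delta>1 > 0" "\<And>w. w \<noteq> 0 \<Longrightarrow> norm w < \<delta>1 \<Longrightarrow> Re (w * deriv g w / g w) > 0"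
    by (auto simp: eventually_at dist_norm)
  obtain \<delta>2 where \<delta>2: "\<delta>2 > 0" "ball 0 \<delta>2 \<subseteq> \<psi> ` ball 0 r"
    using r(3) 0 by (meson openE)
  define \<delta> where "\<delta> = min \<delta>1 \<delta>2"
  have \<delta>: "\<delta> > 0" "ball 0 \<delta> \<subseteq> \<psi> ` ball 0 r"
    using \<delta>1(1) \<delta>2 by (auto simp: \<delta>_def)
  have "isCont \<psi> 0"
    using assms(1,2) continuous_on_eq_continuous_at holomorphic_on_imp_continuous_on
    by (metis centre_in_ball open_ball)
  then have "\<forall>\<^sub>F z in nhds 0. norm (\<psi> z) < \<delta>"
    using isCont_eventually_near[where h = \<psi> and x = 0 and e = \<delta>] \<delta>(1) assms(3) by simp
  then obtain \<epsilon> where \<epsilon>: "\<epsilon> > 0" "\<And>z. norm z < \<epsilon> \<Longrightarrow> norm (\<psi> z) < \<delta>"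
    by (auto simp: eventually_nhds_metric)
  show ?thesis
  proof
    show "\<delta> > 0" by fact
    show "min \<epsilon> r > 0" using \<epsilon>(1) r(1) by simp
    show "g holomorphic_on ball 0 \<delta>"
      using g(1) \<delta>(2) by (rule holomorphic_on_subset)
    show "inj_on g (ball 0 \<delta>)"
      using \<delta>(2) g(3) by (intro inj_on_subset[OF _ \<delta>(2)]) (auto simp: inj_on_def)
    show "g 0 = 0" by fact
    show "((\<lambda>w. g w / w) \<longlongrightarrow> 1 / deriv \<psi> 0) (at 0)"
      using quot dg0 by simp
    show "Re (w * deriv g w / g w) > 0" if "w \<in> ball 0 \<delta>" "w \<noteq> 0" for w
      using that \<delta>1(2) by (simp add: \<delta>_def)
    show "\<psi> z \<in> ball 0 \<delta> \<and> g (\<psi> z) = z" if "z \<in> ball 0 (min \<epsilon> r)" for z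
      using that \<epsilon>(2) g(3) by simp
  qed
qed

lemma real_analytic_on_ray:
  assumes g: "g holomorphic_on ball 0 \<delta>" and u: "\<And>t. t \<in> I \<Longrightarrow> of_real t * u \<in> ball 0 \<delta>"
  shows "real_analytic_on (\<lambda>t. g (of_real t * u)) I"
  unfolding real_analytic_on_def
proof
  fix t0 assume "t0 \<in> I"
  define w0 where "w0 = of_real t0 * u"
  have "w0 \<in> ball 0 \<delta>"
    using u \<open>t0 \<in> I\<close> by (simp add: w0_def)
  then obtain e where e: "e > 0" "ball w0 e \<subseteq> ball 0 \<delta>"
    by (meson open_ball openE)
  define \<epsilon> where "\<epsilon> = e / (norm u + 1)"
  have "\<epsilon> > 0"
    using e(1) by (simp add: \<epsilon>_def add_nonneg_pos)
  moreover have "(\<lambda>n. ((deriv ^^ n) g w0 / fact n * u ^ n) * of_real (t - t0) ^ n) sums g (of_real t * u)"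
    if "\<bar>t - t0\<bar> < \<epsilon>" for t
  proof -
    have "norm (of_real t * u - w0) = \<bar>t - t0\<bar> * norm u"
      by (metis left_diff_distrib norm_mult norm_of_real of_real_diff w0_def)
    also have "\<dots> \<le> \<bar>t - t0\<bar> * (norm u + 1)"
      by (intro mult_left_mono) auto
    also have "\<dots> < e"
      using that pos_less_divide_eq[of "norm u + 1" "\<bar>t - t0\<bar>" e] by (simp add: \<epsilon>_def add_nonneg_pos)
    finally have "of_real t * u \<in> ball w0 e"
      by (simp add: dist_norm norm_minus_commute)
    from holomorphic_power_series[OF holomorphic_on_subset[OF g e(2)] this]
    have "(\<lambda>n. (deriv ^^ n) g w0 / fact n * (of_real t * u - w0) ^ n) sums g (of_real t * u)" .
    moreover have "of_real t * u - w0 = of_real (t - t0) * u"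
      by (simp add: w0_def algebra_simps)
    ultimately show ?thesis
      by (simp add: power_mult_distrib mult_ac)
  qed
  ultimately show "\<exists>c. \<exists>\<epsilon>>0. \<forall>t\<in>I. \<bar>t - t0\<bar> < \<epsilon> \<longrightarrow>
      (\<lambda>n. c n * of_real (t - t0) ^ n) sums g (of_real t * u)"
    by (intro exI[of _ "\<lambda>n. (deriv ^^ n) g w0 / fact n * u ^ n"] exI[of _ \<epsilon>]) auto
qed

lemma has_vector_derivative_ray:
  assumes g: "g holomorphic_on ball 0 \<delta>" and t: "of_real t * u \<in> ball 0 \<delta>"
  shows "((\<lambda>t. g (of_real t * u)) has_vector_derivative u * deriv g (of_real t * u)) (at t within S)"
proof -
  have "((\<lambda>t. of_real t * u) has_vector_derivative u) (at t)"
    by (auto intro!: derivative_eq_intros)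
  moreover have "(g has_field_derivative deriv g (of_real t * u)) (at (of_real t * u))"
    using holomorphic_derivI[OF g open_ball t] by simp
  ultimately have "((\<lambda>t. g (of_real t * u)) has_vector_derivative u * deriv g (of_real t * u)) (at t)"
    using field_vector_diff_chain_at[of "\<lambda>t. of_real t * u" u t g] by (simp add: o_def)
  then show ?thesis
    by (rule has_vector_derivative_at_within)
qed

text \<open>
  The curve is the restriction of a holomorphic injection to a segment, after rescaling the
  parameter to (0,1].
\<close>

lemma analytic_curve_to_zero_ray:
  assumes g: "g holomorphic_on ball 0 \<delta>" "inj_on g (ball 0 \<delta>)" "g 0 = 0"
    and u: "norm u = 1" and T: "0 < T" "T < \<delta>"
  shows "analytic_curve_to_zero ((\<lambda>t. g (of_real t * u)) ` {0<..T})"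
proof -
  define v where "v = of_real T * u"
  have in_ball: "of_real t * v \<in> ball 0 \<delta>" if "\<bar>t\<bar> \<le> 1" for t
  proof -
    have "\<bar>t\<bar> * T \<le> 1 * T"
      using that T by (intro mult_right_mono) auto
    then show ?thesis
      using T u unfolding mem_ball_0 v_def norm_mult norm_of_real by (simp; linarith)
  qed
  have "v \<noteq> 0"
    using T u by (auto simp: v_def)
  define \<gamma> where "\<gamma> t = g (of_real t * v)" for t :: real
  have "real_analytic_on \<gamma> {0<..1}"
    unfolding \<gamma>_def using g(1) in_ball by (intro real_analytic_on_ray) auto
  moreover have "inj_on \<gamma> {0<..1}"
  proof (rule inj_onI)
    fix s t :: real assume st: "s \<in> {0<..1}" "t \<in> {0<..1}" "\<gamma> s = \<gamma> t"
    then have "of_real s * v = of_real t * v"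
      using g(2) in_ball[of s] in_ball[of t] by (auto simp: \<gamma>_def dest: inj_onD)
    then show "s = t"
      using \<open>v \<noteq> 0\<close> by simp
  qed
  moreover have "vector_derivative \<gamma> (at t within {0<..1}) \<noteq> 0" if "t \<in> {0<..1}" for t
  proof -
    have "t islimpt {0<..<t}"
      using that by (intro islimpt_greaterThanLessThan2) simp
    then have "t islimpt {0<..1}"
      using that by (elim islimpt_subset) auto
    then have "vector_derivative \<gamma> (at t within {0<..1}) = v * deriv g (of_real t * v)"
      unfolding \<gamma>_def using g(1) in_ball[of t] that
      by (intro vector_derivative_within has_vector_derivative_ray) (auto simp: trivial_limit_within)
    moreover have "deriv g (of_real t * v) \<noteq> 0"
      using holomorphic_injective_imp_regular[OF g(1) open_ball g(2)] in_ball[of t] that by simp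
    ultimately show ?thesis
      using \<open>v \<noteq> 0\<close> by simp
  qed
  moreover have "(\<gamma> \<longlongrightarrow> 0) (at_right 0)"
  proof -
    have "(\<gamma> has_vector_derivative v * deriv g (of_real 0 * v)) (at 0 within {0<..})"
      unfolding \<gamma>_def using g(1) in_ball[of 0] by (intro has_vector_derivative_ray) auto
    then have "continuous (at 0 within {0<..}) \<gamma>"
      by (rule has_vector_derivative_continuous)
    then show ?thesis
      using g(3) by (simp add: continuous_within \<gamma>_def)
  qed
  moreover have "(\<lambda>t. g (of_real t * u)) ` {0<..T} = \<gamma> ` {0<..1}"
  proof -
    have "{0<..T} = (\<lambda>t. t * T) ` {0<..1}"
    proof safe
      fix t assume "t \<in> {0<..T}"
      then show "t \<in> (\<lambda>t. t * T) ` {0<..1}"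
        using T(1) by (intro image_eqI[of _ _ "t / T"]) auto
    next
      fix t :: real assume "t \<in> {0<..1}"
      then show "t * T \<in> {0<..T}"
        using T(1) by auto
    qed
    then show ?thesis
      by (simp add: image_image \<gamma>_def v_def mult_ac)
  qed
  ultimately show ?thesis
    unfolding analytic_curve_to_zero_def by blast
qed

lemma norm_strict_mono_on_ray:
  assumes g: "g holomorphic_on ball 0 \<delta>" "inj_on g (ball 0 \<delta>)" "g 0 = 0"
    and rad: "\<And>w. w \<in> ball 0 \<delta> \<Longrightarrow> w \<noteq> 0 \<Longrightarrow> Re (w * deriv g w / g w) > 0"
    and u: "norm u = 1"
  shows "strict_mono_on {0<..<\<delta>} (\<lambda>t. norm (g (of_real t * u)))"
proof (rule strict_mono_onI)
  fix s t assume st: "s \<in> {0<..<\<delta>}" "t \<in> {0<..<\<delta>}" "s < t"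
  have "(norm (g (of_real s * u)))\<^sup>2 < (norm (g (of_real t * u)))\<^sup>2"
  proof (rule DERIV_pos_imp_increasing[OF \<open>s < t\<close>])
    fix x assume x: "s \<le> x" "x \<le> t"
    define w where "w = of_real x * u"
    have w: "w \<in> ball 0 \<delta>" "w \<noteq> 0" "x > 0"
      using x st u by (auto simp: w_def norm_mult)
    then have "g w \<noteq> 0"
      using g(2,3) by (metis centre_in_ball inj_onD mem_ball dist_0_norm norm_ge_zero order_le_less_trans)
    have "x * Re (u * deriv g w * cnj (g w)) = Re (w * deriv g w * cnj (g w))"
      by (simp add: w_def algebra_simps)
    also have "w * deriv g w * cnj (g w) = of_real ((norm (g w))\<^sup>2) * (w * deriv g w / g w)"
      using \<open>g w \<noteq> 0\<close> complex_norm_square[of "g w"] by (simp add: field_simps)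
    also have "Re \<dots> = (norm (g w))\<^sup>2 * Re (w * deriv g w / g w)"
      by (rule Re_of_real_times)
    also have "\<dots> > 0"
      using rad[OF w(1,2)] \<open>g w \<noteq> 0\<close> by (intro mult_pos_pos) auto
    finally have "Re (u * deriv g w * cnj (g w)) > 0"
      using \<open>x > 0\<close> by (simp add: zero_less_mult_iff)
    moreover have "((\<lambda>t. g (of_real t * u)) has_vector_derivative u * deriv g w) (at x)"
      using has_vector_derivative_ray[OF g(1), of x u UNIV] w(1) by (simp add: w_def)
    ultimately show "\<exists>y. ((\<lambda>t. (norm (g (of_real t * u)))\<^sup>2) has_real_derivative y) (at x) \<and> 0 < y"
      using DERIV_norm_power2[of "\<lambda>t. g (of_real t * u)" "u * deriv g w" x] by (auto simp: w_def)
  qed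
  then show "norm (g (of_real s * u)) < norm (g (of_real t * u))"
    by (rule power2_less_imp_less) simp
qed

section \<open>Counting the curves\<close>

text \<open>
  The elements of J are congruent modulo q = k / \<mu>, so they are told apart by their quotients by q,
  which are less than \<mu>.
\<close>

lemma card_le_if_pairwise_congruent:
  fixes k \<mu> :: nat
  assumes J: "J \<subseteq> {..<k}" and "\<mu> dvd k" "\<mu> \<ge> 1" "k \<ge> 1"
    and cong: "\<And>i j. i \<in> J \<Longrightarrow> j \<in> J \<Longrightarrow> i < j \<Longrightarrow> k dvd (j - i) * \<mu>"
  shows "card J \<le> \<mu>"
proof -
  obtain q where q: "k = q * \<mu>"
    using \<open>\<mu> dvd k\<close> by (metis dvd_def mult.commute)
  with \<open>k \<ge> 1\<close> have "q > 0"
    by (cases q) auto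
  have mod: "i mod q = j mod q" if "i \<in> J" "j \<in> J" "i < j" for i j
  proof -
    have "q dvd j - i"
      using cong[OF that] \<open>\<mu> \<ge> 1\<close> by (simp add: q)
    then show ?thesis
      using \<open>i < j\<close> by (metis less_imp_le_nat mod_eq_dvd_iff_nat)
  qed
  have "inj_on (\<lambda>j. j div q) J"
  proof (rule inj_onI)
    fix i j assume ij: "i \<in> J" "j \<in> J" "i div q = j div q"
    then have "i mod q = j mod q"
      using mod[of i j] mod[of j i] by (metis linorder_neqE_nat)
    with ij show "i = j"
      by (metis div_mult_mod_eq)
  qed
  moreover have "(\<lambda>j. j div q) ` J \<subseteq> {..<\<mu>}"
    using J by (auto simp: q intro!: less_mult_imp_div_less simp: mult.commute[of \<mu>])
  ultimately show ?thesis
    using card_inj_on_le[of "\<lambda>j. j div q" J "{..<\<mu>}"] by simp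
qed

text \<open>
  Let J be the set of rays whose images meet the maximum modulus set arbitrarily close to 0. On a small
  circle the maxima lie on the curves with index in J, one point per curve, so there are at most
  card J of them, and card J is at most \<mu>. Rotational symmetry yields \<mu> distinct maxima. Equality
  holds throughout, which shows at the same time that card J = \<mu> and that every point of these curves is a
  maximum.
\<close>

lemma max_modulus_set_from_rays:
  fixes f g :: "complex \<Rightarrow> complex" and k \<mu> :: nat
  defines "u \<equiv> \<lambda>j::nat. cis (2 * pi * j / k)"
  assumes f: "continuous_on UNIV f" and rot: "\<And>z. f (cis (2 * pi / \<mu>) * z) = f z"
    and \<mu>: "\<mu> dvd k" "\<mu> \<ge> 1" and k: "k \<ge> 1"
    and g: "g holomorphic_on ball 0 \<delta>" "inj_on g (ball 0 \<delta>)" "g 0 = 0" and "\<delta> > 0" "\<epsilon> > 0"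
    and rad: "\<And>w. w \<in> ball 0 \<delta> \<Longrightarrow> w \<noteq> 0 \<Longrightarrow> Re (w * deriv g w / g w) > 0"
    and cover: "\<And>z. z \<in> ball 0 \<epsilon> \<Longrightarrow> z \<in> max_modulus_set f \<Longrightarrow> \<exists>j<k. \<exists>t. 0 \<le> t \<and> t < \<delta> \<and> z = g (of_real t * u j)"
    and compare: "\<And>i j. i < j \<Longrightarrow> j < k \<Longrightarrow> \<not> k dvd (j - i) * \<mu> \<Longrightarrow>
        (\<forall>\<^sub>F t in at_right 0. g (of_real t * u i) \<notin> max_modulus_set f) \<or>
        (\<forall>\<^sub>F t in at_right 0. g (of_real t * u j) \<notin> max_modulus_set f)"
  shows "\<exists>R>0. \<exists>\<Gamma>. finite \<Gamma> \<and> card \<Gamma> = \<mu> \<and>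
           (\<forall>C\<in>\<Gamma>. analytic_curve_to_zero C) \<and> disjoint \<Gamma> \<and>
           max_modulus_set f \<inter> {z. 0 < norm z \<and> norm z \<le> R} = \<Union>\<Gamma>"
proof -
  let ?M = "max_modulus_set f"
  define J where "J = {j. j < k \<and> \<not> (\<forall>\<^sub>F t in at_right 0. g (of_real t * u j) \<notin> ?M)}"
  have J: "J \<subseteq> {..<k}" "finite J"
    by (auto simp: J_def)
  have card_J: "card J \<le> \<mu>"
  proof (rule card_le_if_pairwise_congruent[OF J(1) \<mu> k])
    fix i j assume "i \<in> J" "j \<in> J" "i < j"
    then show "k dvd (j - i) * \<mu>"
      using compare[of i j] unfolding J_def by blast
  qed
  have norm_u [simp]: "norm (u j) = 1" for j
    by (simp add: u_def)
  have in_ball: "of_real t * u j \<in> ball 0 \<delta>" if "0 \<le> t" "t < \<delta>" for t j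
    using that by (simp add: norm_mult)
  define \<nu> where "\<nu> j t = norm (g (of_real t * u j))" for j :: nat and t :: real
  have mono: "strict_mono_on {0<..<\<delta>} (\<nu> j)" for j
    unfolding \<nu>_def using norm_strict_mono_on_ray[OF g rad norm_u] by simp
  have \<nu>_pos: "\<nu> j t > 0" if "0 < t" "t < \<delta>" for j t
  proof -
    have "g (of_real t * u j) \<noteq> g 0"
      using inj_onD[OF g(2) _ in_ball[of t j]] in_ball[of 0 j] that norm_u[of j] \<open>\<delta> > 0\<close>
      by (metis centre_in_ball less_eq_real_def mult_eq_0_iff norm_zero of_real_eq_0_iff order_less_irrefl zero_neq_one)
    then show ?thesis
      using g(3) by (simp add: \<nu>_def)
  qed
  have "\<forall>\<^sub>F t in at_right 0. \<forall>j\<in>{..<k} - J. g (of_real t * u j) \<notin> ?M"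
    by (intro eventually_ball_finite) (auto simp: J_def)
  then obtain \<tau> where "\<tau> > 0" and \<tau>: "\<And>t j. 0 < t \<Longrightarrow> t < \<tau> \<Longrightarrow> j < k \<Longrightarrow> j \<notin> J \<Longrightarrow> g (of_real t * u j) \<notin> ?M"
    unfolding eventually_at_right_field by auto
  define s where "s = min \<tau> \<delta> / 2"
  have s: "0 < s" "s < \<tau>" "s < \<delta>"
    using \<open>\<tau> > 0\<close> \<open>\<delta> > 0\<close> by (auto simp: s_def min_def)
  \<comment> \<open>Up to modulus R every curve is still inside the range of parameters below \<tau>.\<close>
  define R where "R = min (\<epsilon> / 2) (Min ((\<lambda>j. \<nu> j s) ` {..<k}))"
  have "{..<k} \<noteq> {}"
    using k by (metis lessThan_empty_iff not_one_le_zero)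
  then have "Min ((\<lambda>j. \<nu> j s) ` {..<k}) > 0"
    using \<nu>_pos[of s] s by (subst Min_gr_iff) auto
  then have "R > 0"
    using \<open>\<epsilon> > 0\<close> by (simp add: R_def)
  have "R < \<epsilon>"
    using \<open>\<epsilon> > 0\<close> by (simp add: R_def min_def)
  have R_le: "R \<le> \<nu> j s" if "j < k" for j
  proof -
    have "Min ((\<lambda>j. \<nu> j s) ` {..<k}) \<le> \<nu> j s"
      using that by (intro Min_le) auto
    then show ?thesis
      by (simp add: R_def)
  qed
  have "\<exists>T. 0 < T \<and> T \<le> s \<and> \<nu> j T = R" if jk: "j < k" for j
  proof -
    have "continuous_on {0..s} (\<nu> j)"
      unfolding \<nu>_def using s in_ball[of _ j]
      by (intro continuous_intros continuous_on_compose2[OF holomorphic_on_imp_continuous_on[OF g(1)]]) auto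
    moreover have "\<nu> j 0 = 0"
      using g(3) by (simp add: \<nu>_def)
    ultimately obtain T where T: "0 \<le> T" "T \<le> s" "\<nu> j T = R"
      using IVT'[of "\<nu> j" 0 R s] R_le[OF jk] \<open>R > 0\<close> s by auto
    then have "T \<noteq> 0"
      using \<open>R > 0\<close> \<open>\<nu> j 0 = 0\<close> by auto
    with T show ?thesis
      by (intro exI[of _ T]) auto
  qed
  then obtain T where T: "\<And>j. j < k \<Longrightarrow> 0 < T j \<and> T j \<le> s \<and> \<nu> j (T j) = R"
    by metis
  define C where "C j = (\<lambda>t. g (of_real t * u j)) ` {0<..T j}" for j
  have C_iff: "z \<in> C j \<longleftrightarrow> (\<exists>t. 0 < t \<and> t < \<delta> \<and> \<nu> j t \<le> R \<and> z = g (of_real t * u j))" if "j < k" for j z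
  proof -
    have "\<nu> j t \<le> R \<longleftrightarrow> t \<le> T j" if "0 < t" "t < \<delta>" for t
      using strict_mono_on_less_eq[OF mono[of j], of t "T j"] that T[OF \<open>j < k\<close>] s by auto
    then show ?thesis
      using T[OF that] s by (auto simp: C_def image_iff)
  qed
  have C_norm: "0 < norm z \<and> norm z \<le> R" if "j < k" "z \<in> C j" for j z
    using that \<nu>_pos by (auto simp: C_iff \<nu>_def)
  have C_unique: "z = z'" if zz: "j < k" "z \<in> C j" "z' \<in> C j" "norm z = norm z'" for j z z'
  proof -
    obtain t t' where t: "0 < t" "t < \<delta>" "z = g (of_real t * u j)"
      and t': "0 < t'" "t' < \<delta>" "z' = g (of_real t' * u j)"
      using zz C_iff by auto
    then have "\<nu> j t = \<nu> j t'"
      using zz(4) by (simp add: \<nu>_def)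
    then have "t = t'"
      using inj_onD[OF strict_mono_on_imp_inj_on[OF mono[of j]]] t t' by auto
    then show ?thesis
      using t t' by simp
  qed
  have u_inj: "i = j" if "u i = u j" "i < k" "j < k" for i j
    using that Complex.bij_betw_roots_unity[of k] k by (auto simp: bij_betw_def inj_on_def u_def)
  have C_disjoint: "i = j" if ij: "i < k" "j < k" and zz: "z \<in> C i" "z \<in> C j" for i j z
  proof -
    obtain t t' where t: "0 < t" "t < \<delta>" "z = g (of_real t * u i)"
      and t': "0 < t'" "t' < \<delta>" "z = g (of_real t' * u j)"
      using zz C_iff ij by auto
    then have eq: "of_real t * u i = of_real t' * u j"
      using inj_onD[OF g(2), of "of_real t * u i" "of_real t' * u j"] in_ball by auto
    then have "norm (of_real t * u i) = norm (of_real t' * u j)"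
      by simp
    then have "t = t'"
      using t(1) t'(1) by (simp add: norm_mult)
    then show ?thesis
      using eq t(1) u_inj ij by auto
  qed
  have cover_J: "\<exists>j\<in>J. z \<in> C j" if z: "z \<in> ?M" "0 < norm z" "norm z \<le> R" for z
  proof -
    have "z \<in> ball 0 \<epsilon>"
      using z(3) \<open>R < \<epsilon>\<close> by simp
    then obtain j t where jt: "j < k" "0 \<le> t" "t < \<delta>" "z = g (of_real t * u j)"
      using cover z(1) by blast
    have "t \<noteq> 0"
      using jt(4) z(2) g(3) by auto
    then have "z \<in> C j"
      using jt z(3) by (auto simp: C_iff \<nu>_def intro!: exI[of _ t])
    moreover have "t \<le> s"
    proof (rule ccontr)
      assume "\<not> t \<le> s"
      then have "\<nu> j s < \<nu> j t"
        using s jt(3) by (intro strict_mono_onD[OF mono]) auto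
      then show False
        using R_le[OF jt(1)] z(3) jt(4) by (simp add: \<nu>_def)
    qed
    then have "j \<in> J"
      using \<tau>[of t j] jt z(1) s \<open>t \<noteq> 0\<close> by force
    ultimately show ?thesis
      by blast
  qed
  have circle: "?M \<inter> sphere 0 r = (\<Union>j\<in>J. C j) \<inter> sphere 0 r \<and> card J = \<mu>" if r: "0 < r" "r \<le> R" for r
  proof -
    let ?P = "(\<Union>j\<in>J. C j) \<inter> sphere 0 r"
    obtain z0 where z0: "z0 \<in> ?M" "norm z0 = r"
      using max_modulus_set_meets_circle[OF f, of r] r by auto
    have rot_pow: "f (cis (2 * pi * m / \<mu>) * z) = f z" for m :: nat and z
    proof (induction m)
      case (Suc m)
      have "cis (2 * pi * real (Suc m) / \<mu>) = cis (2 * pi / \<mu>) * cis (2 * pi * m / \<mu>)"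
        by (simp add: cis_mult add_divide_distrib[symmetric] distrib_left)
      then show ?case
        using Suc rot by (simp add: mult.assoc)
    qed simp
    let ?Z = "(\<lambda>m. cis (2 * pi * real m / \<mu>) * z0) ` {..<\<mu>}"
    have "?Z \<subseteq> ?M \<inter> sphere 0 r"
      using z0 by (auto simp: max_modulus_set_iff[OF f] rot_pow norm_mult)
    moreover have card_Z: "card ?Z = \<mu>"
    proof -
      have "inj_on (\<lambda>m. cis (2 * pi * real m / \<mu>)) {..<\<mu>}"
        using Complex.bij_betw_roots_unity[of \<mu>] \<mu>(2) by (simp add: bij_betw_def)
      then have "inj_on (\<lambda>m. cis (2 * pi * real m / \<mu>) * z0) {..<\<mu>}"
        using z0(2) r(1) by (auto simp: inj_on_def)
      then show ?thesis
        by (simp add: card_image)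
    qed
    moreover have sub: "?M \<inter> sphere 0 r \<subseteq> ?P"
      using cover_J r by auto
    moreover have fin: "finite ?P" and "card ?P \<le> card J"
    proof -
      have "\<exists>h. \<forall>z\<in>?P. h z \<in> J \<and> z \<in> C (h z)"
        by (intro bchoice) auto
      then obtain h where h: "\<And>z. z \<in> ?P \<Longrightarrow> h z \<in> J \<and> z \<in> C (h z)"
        by blast
      have "inj_on h ?P"
      proof (rule inj_onI)
        fix z z' assume zz: "z \<in> ?P" "z' \<in> ?P" "h z = h z'"
        then have "norm z = norm z'" by simp
        then show "z = z'"
          using C_unique[of "h z" z z'] h[OF zz(1)] h[OF zz(2)] zz(3) J(1) by auto
      qed
      moreover have "h ` ?P \<subseteq> J"
        using h by blast
      ultimately show "finite ?P" "card ?P \<le> card J"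
        using J(2) by (meson inj_on_finite, meson card_inj_on_le)
    qed
    ultimately have le: "\<mu> \<le> card (?M \<inter> sphere 0 r)" "card (?M \<inter> sphere 0 r) \<le> card ?P"
      by (metis card_mono finite_subset, metis card_mono)
    then have "card (?M \<inter> sphere 0 r) = card ?P" "card J = \<mu>"
      using \<open>card ?P \<le> card J\<close> card_J by linarith+
    then show ?thesis
      using card_subset_eq[OF fin sub] by blast
  qed
  have nonempty: "\<exists>z. z \<in> C j" if "j < k" for j
    using T[OF that] unfolding C_def by (intro exI[of _ "g (of_real (T j) * u j)"]) auto
  have "inj_on C J"
    using J(1) nonempty C_disjoint by (metis inj_onI lessThan_iff subsetD)
  then have "card (C ` J) = \<mu>"
    using circle[of R] \<open>R > 0\<close> by (simp add: card_image)
  moreover have "\<forall>D\<in>C ` J. analytic_curve_to_zero D"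
  proof
    fix D assume "D \<in> C ` J"
    then obtain j where "j < k" "D = C j"
      using J(1) by auto
    then show "analytic_curve_to_zero D"
      unfolding C_def using T[of j] s by (auto intro!: analytic_curve_to_zero_ray[OF g])
  qed
  moreover have "disjoint (C ` J)"
  proof (rule disjointI)
    fix D D' assume D: "D \<in> C ` J" "D' \<in> C ` J" "D \<noteq> D'"
    then obtain i j where ij: "D = C i" "D' = C j" "i < k" "j < k"
      using J(1) by auto
    then show "D \<inter> D' = {}"
      using C_disjoint[of i j] \<open>D \<noteq> D'\<close> by auto
  qed
  moreover have "?M \<inter> {z. 0 < norm z \<and> norm z \<le> R} = \<Union> (C ` J)"
  proof (intro equalityI subsetI)
    fix z assume "z \<in> ?M \<inter> {z. 0 < norm z \<and> norm z \<le> R}"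
    then show "z \<in> \<Union> (C ` J)"
      using cover_J by auto
  next
    fix z assume z: "z \<in> \<Union> (C ` J)"
    then have r: "0 < norm z" "norm z \<le> R"
      using C_norm J(1) by auto
    then show "z \<in> ?M \<inter> {z. 0 < norm z \<and> norm z \<le> R}"
    proof -
      have "z \<in> (\<Union>j\<in>J. C j) \<inter> sphere 0 (norm z)"
        using z by simp
      then have "z \<in> ?M \<inter> sphere 0 (norm z)"
        using circle[OF r] by simp
      with r show ?thesis
        by simp
    qed
  qed
  moreover have "finite (C ` J)"
    using J(2) by simp
  ultimately show ?thesis
    using \<open>R > 0\<close> by (intro exI[of _ R] conjI exI[of _ "C ` J"])
qed

section \<open>Comparing two curves\<close>

text \<open>
  By assumption f(\<omega> z) - f(z) = z^\<sigma> G(z) with G(0) = c_\<sigma> (\<omega>^\<sigma> - 1). Hence the difference of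
  the squared moduli, divided by |z|^\<sigma>, tends to twice the real part in the last hypothesis when z
  tends to 0 in the direction e.
\<close>

lemma rotated_point_larger:
  fixes c :: "nat \<Rightarrow> complex" and z :: "'x \<Rightarrow> complex"
  assumes sums: "\<And>z. (\<lambda>n. c n * z ^ n) sums f z" and "c 0 = 1"
    and agree: "\<And>n. n < \<sigma> \<Longrightarrow> c n * (\<omega> ^ n - 1) = 0"
    and z0: "(z \<longlongrightarrow> 0) F" and dir: "((\<lambda>t. sgn (z t)) \<longlongrightarrow> e) F" and nz: "\<forall>\<^sub>F t in F. z t \<noteq> 0"
    and gt: "Re (e ^ \<sigma> * (c \<sigma> * (\<omega> ^ \<sigma> - 1))) > 0"
  shows "\<forall>\<^sub>F t in F. norm (f (\<omega> * z t)) > norm (f (z t))"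
proof -
  have diff_sums: "(\<lambda>n. c n * (\<omega> ^ n - 1) * z ^ n) sums (f (\<omega> * z) - f z)" for z
    using sums_diff[OF sums[of "\<omega> * z"] sums[of z]] by (simp add: power_mult_distrib algebra_simps)
  obtain G where G: "G holomorphic_on UNIV" "\<And>z. f (\<omega> * z) - f z = z ^ \<sigma> * G z"
      "G 0 = c \<sigma> * (\<omega> ^ \<sigma> - 1)"
    using power_series_divide_power[of "\<lambda>n. c n * (\<omega> ^ n - 1)" "\<lambda>z. f (\<omega> * z) - f z" \<sigma>]
      diff_sums agree by blast
  have f0: "f 0 = 1"
    using powser_sums_zero[of c] sums[of 0] \<open>c 0 = 1\<close> sums_unique2 by fastforce
  have "isCont f 0" "isCont G 0"
    using G(1) power_series_entire[OF sums] holomorphic_on_imp_continuous_on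
      continuous_on_eq_continuous_at[OF open_UNIV] by blast+
  then have lim: "((\<lambda>t. f (z t)) \<longlongrightarrow> 1) F" "((\<lambda>t. G (z t)) \<longlongrightarrow> G 0) F"
    using isCont_tendsto_compose[OF _ z0] f0 by fastforce+
  define H where "H t = 2 * Re (sgn (z t) ^ \<sigma> * G (z t) * cnj (f (z t))) +
    norm (z t) ^ \<sigma> * (norm (G (z t)))\<^sup>2" for t
  have expand: "(norm (f (\<omega> * z t)))\<^sup>2 - (norm (f (z t)))\<^sup>2 = norm (z t) ^ \<sigma> * H t" for t
  proof -
    have "(norm (u + v))\<^sup>2 - (norm u)\<^sup>2 = 2 * Re (v * cnj u) + (norm v)\<^sup>2" for u v :: complex
      unfolding cmod_power2 by (simp add: power2_eq_square algebra_simps)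
    from this[of "f (z t)" "z t ^ \<sigma> * G (z t)"]
    have "(norm (f (\<omega> * z t)))\<^sup>2 - (norm (f (z t)))\<^sup>2 =
        2 * Re (z t ^ \<sigma> * G (z t) * cnj (f (z t))) + (norm (z t ^ \<sigma> * G (z t)))\<^sup>2"
      using G(2)[of "z t"] by (simp add: algebra_simps)
    also have "z t ^ \<sigma> * G (z t) * cnj (f (z t)) =
        of_real (norm (z t) ^ \<sigma>) * (sgn (z t) ^ \<sigma> * G (z t) * cnj (f (z t)))"
    proof -
      have "z t = of_real (norm (z t)) * sgn (z t)"
        by (simp add: sgn_eq)
      then show ?thesis
        by (metis mult.assoc of_real_power power_mult_distrib)
    qed
    finally show ?thesis
      unfolding Re_of_real_times
      by (simp add: H_def norm_mult norm_power power_mult_distrib power2_eq_square algebra_simps)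
  qed
  have "(H \<longlongrightarrow> 2 * Re (e ^ \<sigma> * G 0 * cnj 1) + norm (0::complex) ^ \<sigma> * (norm (G 0))\<^sup>2) F"
    unfolding H_def by (intro tendsto_intros dir lim z0)
  moreover have "2 * Re (e ^ \<sigma> * G 0 * cnj 1) + norm (0::complex) ^ \<sigma> * (norm (G 0))\<^sup>2 > 0"
  proof -
    have "norm (0::complex) ^ \<sigma> * (norm (G 0))\<^sup>2 \<ge> 0"
      by simp
    then show ?thesis
      using gt unfolding G(3) complex_cnj_one mult_1_right by linarith
  qed
  ultimately have "\<forall>\<^sub>F t in F. H t > 0"
    by (rule order_tendstoD)
  with nz show ?thesis
  proof eventually_elim
    case (elim t)
    then have "(norm (f (\<omega> * z t)))\<^sup>2 - (norm (f (z t)))\<^sup>2 > 0"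
      unfolding expand by (intro mult_pos_pos) auto
    then show ?case
      by (intro power2_less_imp_less[of "norm (f (z t))"]) auto
  qed
qed

lemma direction_along_ray:
  fixes g :: "complex \<Rightarrow> complex"
  assumes quot: "((\<lambda>w. g w / w) \<longlongrightarrow> L) (at 0)" "norm L = 1" and u: "norm u = 1"
  shows "((\<lambda>t::real. sgn (g (of_real t * u))) \<longlongrightarrow> L * u) (at_right 0)"
    and "\<forall>\<^sub>F t::real in at_right 0. g (of_real t * u) \<noteq> 0"
    and "((\<lambda>t::real. g (of_real t * u)) \<longlongrightarrow> 0) (at_right 0)"
proof -
  have pos: "\<forall>\<^sub>F t::real in at_right 0. t > 0"
    by (simp add: eventually_at_right_less)
  have "((\<lambda>t::real. of_real t * u) \<longlongrightarrow> of_real 0 * u) (at_right 0)"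
    by (intro tendsto_intros)
  then have ray: "filterlim (\<lambda>t::real. of_real t * u) (at 0) (at_right 0)"
    using u pos by (auto simp: filterlim_at elim!: eventually_mono)
  then have lim: "((\<lambda>t. g (of_real t * u) / (of_real t * u)) \<longlongrightarrow> L) (at_right 0)"
    using filterlim_compose[OF quot(1) ray] by (simp add: o_def)
  have "L \<noteq> 0"
    using quot(2) by auto
  then have "\<forall>\<^sub>F t in at_right 0. g (of_real t * u) / (of_real t * u) \<noteq> 0"
    using lim tendsto_imp_eventually_ne by blast
  then show "\<forall>\<^sub>F t::real in at_right 0. g (of_real t * u) \<noteq> 0"
    by (rule eventually_mono) auto
  have "((\<lambda>t. g (of_real t * u) / (of_real t * u) * (of_real t * u)) \<longlongrightarrow> L * (of_real 0 * u)) (at_right 0)"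
    by (intro tendsto_intros lim)
  then show "((\<lambda>t::real. g (of_real t * u)) \<longlongrightarrow> 0) (at_right 0)"
  proof (rule Lim_transform_eventually[OF tendsto_eq_rhs])
    show "\<forall>\<^sub>F t in at_right 0. g (of_real t * u) / (of_real t * u) * (of_real t * u) = g (of_real t * u)"
      using pos u by (auto elim!: eventually_mono)
  qed simp
  have "((\<lambda>t. sgn (g (of_real t * u) / (of_real t * u)) * u) \<longlongrightarrow> sgn L * u) (at_right 0)"
    using \<open>L \<noteq> 0\<close> by (intro tendsto_intros lim)
  then show "((\<lambda>t::real. sgn (g (of_real t * u))) \<longlongrightarrow> L * u) (at_right 0)"
  proof (rule Lim_transform_eventually[OF tendsto_eq_rhs])
    show "sgn L * u = L * u"
      using quot(2) by (simp add: sgn_eq)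
    show "\<forall>\<^sub>F t in at_right 0. sgn (g (of_real t * u) / (of_real t * u)) * u = sgn (g (of_real t * u))"
      using pos
    proof eventually_elim
      case (elim t)
      have "sgn (of_real t * u) = u"
        using elim u by (simp add: sgn_eq norm_mult)
      moreover have "u \<noteq> 0"
        using u by auto
      ultimately show ?case
        by (simp add: sgn_divide)
    qed
  qed
qed

lemma cos_eq_iff:
  "cos x = cos y \<longleftrightarrow> (\<exists>m::int. x + y = 2 * pi * m) \<or> (\<exists>m::int. y - x = 2 * pi * m)" for x y :: real
proof -
  have "cos x = cos y \<longleftrightarrow> sin ((x + y) / 2) = 0 \<or> sin ((y - x) / 2) = 0"
    using cos_diff_cos[of x y] by auto
  also have "\<dots> \<longleftrightarrow> (\<exists>m::int. x + y = 2 * pi * m) \<or> (\<exists>m::int. y - x = 2 * pi * m)"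
    unfolding sin_zero_iff_int2 by (auto simp: field_simps)
  finally show ?thesis .
qed

text \<open>
  The two numbers have the same modulus, so equal real parts mean that their arguments are either
  opposite or equal modulo 2 \<pi>. Equal arguments would make k divide (j - i) \<sigma>. Opposite arguments
  are the defining equation of an exceptional function with m = i + j, and 1 \<le> i + j \<le> 2 k - 3
  because i < j < k.
\<close>

lemma coefficients_separate_rays:
  fixes k \<sigma> i j :: nat
  assumes nexc: "\<not> exceptional f a k b \<alpha> \<beta>" and \<beta>: "is_Arg (b \<sigma>) (\<beta> \<sigma>)" "b \<sigma> \<noteq> 0"
    and \<sigma>: "\<sigma> \<in> {k + 1..core_index f a k b}" "\<not> k dvd (j - i) * \<sigma>" and ij: "i < j" "j < k"
  shows "Re (b \<sigma> * cis (\<sigma> * ((2 * pi * i - \<alpha>) / k))) \<noteq> Re (b \<sigma> * cis (\<sigma> * ((2 * pi * j - \<alpha>) / k)))"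
proof
  let ?\<theta> = "\<lambda>i. \<beta> \<sigma> + \<sigma> * ((2 * pi * real i - \<alpha>) / k)"
  assume eq: "Re (b \<sigma> * cis (\<sigma> * ((2 * pi * i - \<alpha>) / k))) = Re (b \<sigma> * cis (\<sigma> * ((2 * pi * j - \<alpha>) / k)))"
  have k: "real k > 0" and s: "real \<sigma> > 0"
    using ij \<sigma>(1) by auto
  have "Re (b \<sigma> * cis (\<sigma> * ((2 * pi * real l - \<alpha>) / k))) = norm (b \<sigma>) * cos (?\<theta> l)" for l
  proof -
    have "b \<sigma> = of_real (norm (b \<sigma>)) * cis (\<beta> \<sigma>)"
      using \<beta>(1) by (simp add: is_Arg_def cis_conv_exp)
    then have "b \<sigma> * cis (\<sigma> * ((2 * pi * real l - \<alpha>) / k)) = of_real (norm (b \<sigma>)) * cis (?\<theta> l)"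
      by (metis cis_mult mult.assoc)
    then show ?thesis
      by (simp only: Re_of_real_times cis.sel)
  qed
  then have "cos (?\<theta> i) = cos (?\<theta> j)"
    using eq \<open>b \<sigma> \<noteq> 0\<close> by simp
  then consider m' :: int where "?\<theta> i + ?\<theta> j = 2 * pi * m'" | m :: int where "?\<theta> j - ?\<theta> i = 2 * pi * m"
    unfolding cos_eq_iff by blast
  then show False
  proof cases
    case 1
    define Q where "Q = \<sigma> * (pi * (real i + real j) - \<alpha>) / k"
    have "?\<theta> i + ?\<theta> j = 2 * (\<beta> \<sigma> + Q)"
      using k by (simp add: Q_def field_simps)
    with 1 have "\<beta> \<sigma> + Q = pi * m'"
      by simp
    then have "\<sigma> * (pi * (real i + real j) - \<alpha>) / k = pi * m' - \<beta> \<sigma>"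
      unfolding Q_def[symmetric] by simp
    then have "of_int (int i + int j) * pi = real k / real \<sigma> * (of_int m' * pi - \<beta> \<sigma>) + \<alpha>"
      using k s by (simp add: field_simps)
    moreover have "int i + int j \<in> {1..2 * int k - 3}"
      using ij by auto
    ultimately have "exceptional f a k b \<alpha> \<beta>"
      unfolding exceptional_def using \<sigma>(1) \<beta>(2) by blast
    with nexc show False ..
  next
    case 2
    define Q where "Q = \<sigma> * (real j - real i) / k"
    have "?\<theta> j - ?\<theta> i = 2 * pi * Q"
      using k by (simp add: Q_def field_simps)
    with 2 have "2 * pi * Q = 2 * pi * m"
      by (simp only:)
    then have "Q = m"
      by simp
    then have "\<sigma> * (real j - real i) = k * m"
      using k by (simp add: Q_def field_simps)
    then have "real_of_int (int ((j - i) * \<sigma>)) = real_of_int (int k * m)"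
      using ij by (simp add: of_nat_diff mult.commute)
    then have "int ((j - i) * \<sigma>) = int k * m"
      by (simp only: of_int_eq_iff)
    then have "int k dvd int ((j - i) * \<sigma>)"
      by simp
    then show False
      using \<sigma>(2) by (simp only: int_dvd_int_iff)
  qed
qed

text \<open>
  Rotation by \<theta>_p - \<theta>_q, where \<theta>_p = (2 \<pi> p - \<alpha>) / k, moves the points of curve q to points of larger
  modulus of f on the same circle.
\<close>

lemma ray_eventually_outside:
  fixes k p q \<sigma> :: nat and g :: "complex \<Rightarrow> complex"
  assumes f: "continuous_on UNIV f" and sums: "\<And>z. (\<lambda>n. c n * z ^ n) sums f z" and "c 0 = 1"
    and "k \<ge> 1"
    and agree: "\<And>n. n < \<sigma> \<Longrightarrow> c n \<noteq> 0 \<Longrightarrow> int k dvd (int p - int q) * int n"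
    and gt: "Re (c \<sigma> * cis (\<sigma> * ((2 * pi * p - \<alpha>) / k))) > Re (c \<sigma> * cis (\<sigma> * ((2 * pi * q - \<alpha>) / k)))"
    and quot: "((\<lambda>w. g w / w) \<longlongrightarrow> cis (- \<alpha> / k)) (at 0)"
  shows "\<forall>\<^sub>F t in at_right 0. g (of_real t * cis (2 * pi * q / k)) \<notin> max_modulus_set f"
proof -
  define \<omega> where "\<omega> = cis (2 * pi * (real p - real q) / k)"
  define e where "e = cis ((2 * pi * q - \<alpha>) / k)"
  have omega_e: "\<omega> ^ \<sigma> * e ^ \<sigma> = cis (\<sigma> * ((2 * pi * p - \<alpha>) / k))"
  proof -
    have "2 * pi * (real p - real q) / k + (2 * pi * q - \<alpha>) / k = (2 * pi * p - \<alpha>) / k"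
      by (simp add: add_divide_distrib[symmetric] algebra_simps)
    then have "\<omega> * e = cis ((2 * pi * p - \<alpha>) / k)"
      by (simp add: \<omega>_def e_def cis_mult)
    then show ?thesis
      unfolding power_mult_distrib[symmetric] by (simp add: Complex.DeMoivre)
  qed
  have e_pow: "e ^ \<sigma> = cis (\<sigma> * ((2 * pi * q - \<alpha>) / k))"
    by (simp add: e_def Complex.DeMoivre)
  have "c n * (\<omega> ^ n - 1) = 0" if n: "n < \<sigma>" for n
  proof (cases "c n = 0")
    case False
    then obtain l where "(int p - int q) * int n = int k * l"
      using agree[OF n] by blast
    then have l: "(real p - real q) * real n = real k * of_int l"
      by (metis of_int_diff of_int_mult of_int_of_nat_eq)
    have "real n * (2 * pi * (real p - real q) / k) = 2 * pi * ((real p - real q) * real n) / k"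
      by simp
    also have "\<dots> = 2 * pi * of_int l"
      using \<open>k \<ge> 1\<close> unfolding l by simp
    finally have "\<omega> ^ n = 1"
      unfolding \<omega>_def Complex.DeMoivre by (simp add: cis_multiple_2pi)
    then show ?thesis
      by simp
  qed simp
  moreover have "cis (- \<alpha> / k) * cis (2 * pi * q / k) = e"
    by (simp add: e_def cis_mult diff_divide_distrib)
  moreover have "Re (e ^ \<sigma> * (c \<sigma> * (\<omega> ^ \<sigma> - 1))) > 0"
  proof -
    have "e ^ \<sigma> * (c \<sigma> * (\<omega> ^ \<sigma> - 1)) = c \<sigma> * (\<omega> ^ \<sigma> * e ^ \<sigma>) - c \<sigma> * e ^ \<sigma>"
      by (simp add: algebra_simps)
    also have "\<dots> = c \<sigma> * cis (\<sigma> * ((2 * pi * p - \<alpha>) / k)) - c \<sigma> * cis (\<sigma> * ((2 * pi * q - \<alpha>) / k))"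
      unfolding omega_e by (simp only: e_pow)
    finally show ?thesis
      using gt by (simp only: minus_complex.sel diff_gt_0_iff_gt)
  qed
  ultimately have "\<forall>\<^sub>F t in at_right 0. norm (f (\<omega> * g (of_real t * cis (2 * pi * q / k)))) >
      norm (f (g (of_real t * cis (2 * pi * q / k))))"
    using direction_along_ray[OF quot norm_cis norm_cis, of "2 * pi * q / k"]
    by (intro rotated_point_larger[of c f \<sigma> \<omega> _ _ e] sums \<open>c 0 = 1\<close>) auto
  then show ?thesis
    by (rule eventually_mono) (auto simp: max_modulus_set_iff[OF f] \<omega>_def norm_mult not_le intro!: exI[of _ "\<omega> * _"])
qed

text \<open>
  The curve on which the first separating coefficient contributes the smaller real part loses.
\<close>

lemma inequivalent_rays_separated:
  fixes k i j :: nat and g :: "complex \<Rightarrow> complex"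
  assumes "k \<ge> 1" "a \<noteq> 0"
    and sums: "\<And>z. (\<lambda>n. series_coeff a k b n * z ^ n) sums f z"
    and \<beta>: "\<And>\<sigma>. \<sigma> \<ge> k + 1 \<Longrightarrow> is_Arg (b \<sigma>) (\<beta> \<sigma>)" and nexc: "\<not> exceptional f a k b \<alpha> \<beta>"
    and quot: "((\<lambda>w. g w / w) \<longlongrightarrow> cis (- \<alpha> / k)) (at 0)"
    and ij: "i < j" "j < k" and ndvd: "\<not> k dvd (j - i) * inner_degree f"
  shows "(\<forall>\<^sub>F t in at_right 0. g (of_real t * cis (2 * pi * i / k)) \<notin> max_modulus_set f) \<or>
         (\<forall>\<^sub>F t in at_right 0. g (of_real t * cis (2 * pi * j / k)) \<notin> max_modulus_set f)"
proof -
  let ?c = "series_coeff a k b"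
  let ?P = "\<lambda>n. ?c n \<noteq> 0 \<and> \<not> k dvd (j - i) * n"
  obtain \<sigma>' where \<sigma>': "\<sigma>' \<in> {k+1..core_index f a k b}" "b \<sigma>' \<noteq> 0" "\<not> k dvd (j - i) * \<sigma>'"
    using separating_index_below_core_index[of k a b f "j - i", OF assms(1,2) sums ndvd] by blast
  then have P': "?P \<sigma>'"
    by (simp add: series_coeff_def)
  \<comment> \<open>The least index matters, as the terms below it do not distinguish the two curves.\<close>
  define \<sigma> where "\<sigma> = (LEAST n. ?P n)"
  have P: "?P \<sigma>"
    unfolding \<sigma>_def using P' by (rule LeastI)
  have least: "\<not> ?P n" if "n < \<sigma>" for n
    using that unfolding \<sigma>_def by (rule not_less_Least)
  have le: "\<sigma> \<le> \<sigma>'"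
    unfolding \<sigma>_def using P' by (rule Least_le)
  have "\<sigma> > k" and c_\<sigma>: "?c \<sigma> = b \<sigma>" "b \<sigma> \<noteq> 0"
    using P by (auto simp: series_coeff_def split: if_splits)
  then have \<sigma>: "\<sigma> \<in> {k+1..core_index f a k b}"
    using le \<sigma>'(1) by auto
  have f: "continuous_on UNIV f"
    using power_series_entire[OF sums] by (rule holomorphic_on_imp_continuous_on)
  have agree: "int k dvd (int j - int i) * int n" "int k dvd (int i - int j) * int n"
    if "n < \<sigma>" "?c n \<noteq> 0" for n
  proof -
    have "k dvd (j - i) * n"
      using least[OF that(1)] that(2) by blast
    then have "int k dvd int ((j - i) * n)"
      by (simp only: int_dvd_int_iff)
    then show "int k dvd (int j - int i) * int n"
      using ij(1) by (simp add: of_nat_diff)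
    then show "int k dvd (int i - int j) * int n"
      by (metis dvd_minus_iff minus_diff_eq mult_minus_left)
  qed
  have "Re (?c \<sigma> * cis (\<sigma> * ((2 * pi * i - \<alpha>) / k))) \<noteq> Re (?c \<sigma> * cis (\<sigma> * ((2 * pi * j - \<alpha>) / k)))"
    unfolding c_\<sigma>(1) using \<sigma> P \<beta>[of \<sigma>] c_\<sigma>(2) \<open>\<sigma> > k\<close>
    by (intro coefficients_separate_rays[OF nexc _ _ _ _ ij]) auto
  then consider "Re (?c \<sigma> * cis (\<sigma> * ((2 * pi * i - \<alpha>) / k))) > Re (?c \<sigma> * cis (\<sigma> * ((2 * pi * j - \<alpha>) / k)))"
    | "Re (?c \<sigma> * cis (\<sigma> * ((2 * pi * j - \<alpha>) / k))) > Re (?c \<sigma> * cis (\<sigma> * ((2 * pi * i - \<alpha>) / k)))"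
    by linarith
  then show ?thesis
  proof cases
    case 1
    then show ?thesis
      using ray_eventually_outside[OF f sums _ \<open>k \<ge> 1\<close> agree(2) _ quot] by (simp add: series_coeff_def)
  next
    case 2
    then show ?thesis
      using ray_eventually_outside[OF f sums _ \<open>k \<ge> 1\<close> agree(1) _ quot] by (simp add: series_coeff_def)
  qed
qed

section \<open>Structure of the maximum modulus set near the origin\<close>

theorem theorem1p3:
  fixes f :: "complex \<Rightarrow> complex" and a :: complex and k :: nat and b :: "nat \<Rightarrow> complex"
    and \<alpha> :: real and \<beta> :: "nat \<Rightarrow> real"
  assumes "f holomorphic_on UNIV"
    and "k \<ge> 1" and "a \<noteq> 0"
    and "\<And>z. ((\<lambda>\<sigma>. b \<sigma> * z ^ \<sigma>) has_sum (f z - (1 + a * z ^ k))) {k+1..}"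
    and "is_Arg a \<alpha>" and "\<And>\<sigma>. \<sigma> \<ge> k + 1 \<Longrightarrow> is_Arg (b \<sigma>) (\<beta> \<sigma>)"
    and "\<not> exceptional f a k b \<alpha> \<beta>"
  shows "\<exists>R>0. \<exists>\<Gamma>. finite \<Gamma> \<and> card \<Gamma> = inner_degree f \<and>
           (\<forall>C\<in>\<Gamma>. analytic_curve_to_zero C) \<and> disjoint \<Gamma> \<and>
           max_modulus_set f \<inter> {z. 0 < norm z \<and> norm z \<le> R} = \<Union>\<Gamma>"
proof -
  let ?c = "series_coeff a k b" and ?\<mu> = "inner_degree f"
  have sums: "(\<lambda>n. ?c n * z ^ n) sums f z" for z
    using assms(2,4) by (rule series_coeff_sums)
  have f: "continuous_on UNIV f"
    using assms(1) by (rule holomorphic_on_imp_continuous_on)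
  have ck: "?c k \<noteq> 0"
    using assms(2,3) by (simp add: series_coeff_def)
  have \<mu>: "?\<mu> = Gcd {n. ?c n \<noteq> 0}"
    using inner_degree_eq_Gcd[OF sums ck assms(2)] .
  have \<mu>_dvd: "?\<mu> dvd k" and \<mu>_dvd_all: "\<forall>n. ?c n \<noteq> 0 \<longrightarrow> ?\<mu> dvd n"
    unfolding \<mu> using ck by (auto intro: Gcd_dvd)
  then have \<mu>_pos: "?\<mu> \<ge> 1"
    using assms(2) by (metis One_nat_def Suc_leI dvd_0_left_iff gr0I not_one_le_zero)
  have rot: "f (cis (2 * pi / ?\<mu>) * z) = f z" for z
    using power_series_rotation_invariant_iff[OF sums \<mu>_pos] \<mu>_dvd_all by blast

  have tail: "(\<lambda>n. (if n = 0 then 0 else ?c n) * z ^ n) sums (f z - 1)" for z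
  proof -
    have "(\<lambda>n. ?c n * z ^ n - (if n = 0 then 1 else 0)) sums (f z - 1)"
      using sums_diff[OF sums sums_single[of 0 "\<lambda>_. 1"]] by simp
    also have "(\<lambda>n. ?c n * z ^ n - (if n = 0 then 1 else 0)) = (\<lambda>n. (if n = 0 then 0 else ?c n) * z ^ n)"
      by (auto simp: series_coeff_def)
    finally show ?thesis .
  qed
  have zero: "(if n = 0 then 0 else ?c n) = 0" if "n < k" for n
    using that by (simp add: series_coeff_def)
  have lead: "(if k = 0 then 0 else ?c k) = a"
    using assms(2) by (simp add: series_coeff_def)
  obtain B where B: "B holomorphic_on UNIV" "\<And>z. f z - 1 = z ^ k * B z" "B 0 = a"
    by (rule power_series_divide_power[where m = k, OF tail zero, unfolded lead], assumption) (rule that)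
  have fB: "f z = 1 + z ^ k * B z" for z
    using B(2)[of z] by (simp add: algebra_simps)
  obtain \<psi> \<rho> where \<psi>: "\<rho> > 0" "\<psi> holomorphic_on ball 0 \<rho>" "\<psi> 0 = 0" "deriv \<psi> 0 = cis (\<alpha> / k)"
    "\<And>z. z \<in> ball 0 \<rho> \<Longrightarrow> z \<in> max_modulus_set f \<Longrightarrow>
       \<exists>j<k. \<psi> z = of_real (norm (\<psi> z)) * cis (2 * pi * j / k)"
    by (rule straightening_coordinate[OF assms(1) B(1) fB assms(2) B(3) assms(3,5)]) (rule that)
  have "deriv \<psi> 0 \<noteq> 0"
    using \<psi>(4) by simp
  obtain g \<delta> \<epsilon> where g: "\<delta> > 0" "\<epsilon> > 0" "g holomorphic_on ball 0 \<delta>" "inj_on g (ball 0 \<delta>)" "g 0 = 0"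
    "((\<lambda>w. g w / w) \<longlongrightarrow> 1 / deriv \<psi> 0) (at 0)"
    "\<And>w. w \<in> ball 0 \<delta> \<Longrightarrow> w \<noteq> 0 \<Longrightarrow> Re (w * deriv g w / g w) > 0"
    "\<And>z. z \<in> ball 0 \<epsilon> \<Longrightarrow> \<psi> z \<in> ball 0 \<delta> \<and> g (\<psi> z) = z"
    by (rule conformal_inverse_radially_increasing[OF \<psi>(2,1,3) \<open>deriv \<psi> 0 \<noteq> 0\<close>]) (rule that)
  have quot: "((\<lambda>w. g w / w) \<longlongrightarrow> cis (- \<alpha> / k)) (at 0)"
    using g(6) unfolding \<psi>(4) by (simp add: divide_inverse flip: cis_inverse)
  have cover: "\<exists>j<k. \<exists>t. 0 \<le> t \<and> t < \<delta> \<and> z = g (of_real t * cis (2 * pi * j / k))"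
    if z: "z \<in> ball 0 (min \<epsilon> \<rho>)" "z \<in> max_modulus_set f" for z
  proof -
    obtain j where j: "j < k" "\<psi> z = of_real (norm (\<psi> z)) * cis (2 * pi * j / k)"
      using \<psi>(5) z by auto
    have "\<psi> z \<in> ball 0 \<delta>" "g (\<psi> z) = z"
      using g(8) z(1) by auto
    with j show ?thesis
      by (intro exI[of _ j] conjI exI[of _ "norm (\<psi> z)"]) auto
  qed
  have "min \<epsilon> \<rho> > 0"
    using \<psi>(1) g(2) by simp
  show ?thesis
    using max_modulus_set_from_rays[OF f rot \<mu>_dvd \<mu>_pos assms(2) g(3,4,5,1) \<open>min \<epsilon> \<rho> > 0\<close> g(7) cover
        inequivalent_rays_separated[OF assms(2,3) sums assms(6,7) quot]] .
qed

end
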